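(* Let $N\ge 1$, $s\in(0,1)$, $a>0$, let $B_\rho(x_0)\subset\mathbb{R}^N$ be a ball, let $f$ be a locally Lipschitz function such that $f(t)$ is non-increasing for nonnegative and small values of $t$ and such that $f(a)\le0$, and let $u\in\mathcal{C}^s(\mathbb{R}^N)$ be a weak solution of \[ \begin{cases} (-\Delta)^s u= f(u) & \text{in } \mathbb{R}^N\setminus\overline{B_\rho(x_0)},\\ u=a & \text{in } \overline{B_\rho(x_0)}, \end{cases} \] with $u(x)\to0$ as $|x|\to+\infty$. (1) If $0\le u\le a$ in $\mathbb{R}^N\setminus\overline{B_\rho(x_0)}$, then $u$ is radially symmetric and radially decreasing with respect to $x_0$. (2) If moreover $f(t)\le0$ for every $t\ge0$, then the same conclusion holds under the only condition $u\ge0$ in $\mathbb{R}^N\setminus\overline{B_\rho(x_0)}$ (in place of $0\le u\le a$).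
   Context: The fractional Laplacian is $(-\Delta)^s u(x)=c_{N,s}\,\mathrm{P.V.}\int_{\mathbb{R}^N}\frac{u(x)-u(y)}{|x-y|^{N+2s}}\,dy$, with $c_{N,s}>0$ a normalization constant. Set $\mathcal{E}(u,v)=\frac{c_{N,s}}{2}\int_{\mathbb{R}^{2N}}\frac{(u(x)-u(y))(v(x)-v(y))}{|x-y|^{N+2s}}\,dx\,dy$, and let $\mathcal{D}^s(\mathbb{R}^N)$ be the completion of $\mathcal{C}^\infty_c(\mathbb{R}^N)$ with respect to the norm induced by $\mathcal{E}$. A weak solution of $(-\Delta)^s w=g$ in an open set $U$ is a function $w\in\mathcal{D}^s(\mathbb{R}^N)$ with $\mathcal{E}(w,\varphi)=\int_U g\varphi\,dx$ for every $\varphi\in\mathcal{C}_c^\infty(U)$; here $g=f(u)$. $\mathcal{C}^s(\mathbb{R}^N)$ is the space of $s$-Hölder continuous functions. "$f(t)$ is non-increasing for nonnegative and small values of $t$" means that there is $t_0>0$ such that $f$ is non-increasing on $[0,t_0]$. "Radially decreasing with respect to $x_0$" means that $u$, as a function of $|x-x_0|$, is strictly decreasing in $\mathbb{R}^N\setminus\overline{B_\rho(x_0)}$ (it is constant on $\overline{B_\rho(x_0)}$). *)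

theory Defs
  imports "HOL-Analysis.Analysis"
begin

text \<open>The ambient space \<open>\<real>\<^sup>N\<close> is a type \<open>'a::euclidean_space\<close>, with \<open>N = DIM('a)\<close>.\<close>

text \<open>\<open>C\<^sup>k\<close> on the whole space, by recursion on \<open>k\<close>: \<open>\<phi>\<close> is differentiable everywhere and all its
  directional derivatives \<open>x \<mapsto> D\<phi>(x)h\<close> are \<open>C\<^sup>k\<^sup>-\<^sup>1\<close>.\<close>

primrec Ck :: "nat \<Rightarrow> ('a::euclidean_space \<Rightarrow> real) \<Rightarrow> bool" where
  "Ck 0 \<phi> \<longleftrightarrow> continuous_on UNIV \<phi>"
| "Ck (Suc k) \<phi> \<longleftrightarrow> (\<forall>x. \<phi> differentiable (at x)) \<and>
     (\<forall>h. Ck k (\<lambda>x. frechet_derivative \<phi> (at x) h))"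

definition test_functions :: "'a::euclidean_space set \<Rightarrow> ('a \<Rightarrow> real) set" where
  "test_functions U = {\<phi>. (\<forall>k. Ck k \<phi>) \<and>
     compact (closure {x. \<phi> x \<noteq> 0}) \<and> closure {x. \<phi> x \<noteq> 0} \<subseteq> U}"

text \<open>On the diagonal the integrand takes the value \<open>0 / 0 = 0\<close>; the diagonal is a null set.\<close>

definition energy_integrand ::
    "real \<Rightarrow> ('a::euclidean_space \<Rightarrow> real) \<Rightarrow> ('a \<Rightarrow> real) \<Rightarrow> 'a \<times> 'a \<Rightarrow> real" where
  "energy_integrand s u v = (\<lambda>(x, y).
     (u x - u y) * (v x - v y) / norm (x - y) powr (real DIM('a) + 2 * s))"

text \<open>\<open>c\<close> is the normalization constant \<open>c\<^sub>N\<^sub>,\<^sub>s\<close>.\<close>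

definition energy ::
    "real \<Rightarrow> real \<Rightarrow> ('a::euclidean_space \<Rightarrow> real) \<Rightarrow> ('a \<Rightarrow> real) \<Rightarrow> real" where
  "energy c s u v = c / 2 * integral\<^sup>L (lborel \<Otimes>\<^sub>M lborel) (energy_integrand s u v)"

text \<open>The completion of \<open>C\<^sub>c\<^sup>\<infinity>(\<real>\<^sup>N)\<close> in the energy norm, realised as a space of functions: \<open>w\<close>
  belongs to it iff some sequence of test functions converges to \<open>w\<close> both in the energy norm and
  almost everywhere. Energy convergence alone would determine \<open>w\<close> only up to an additive constant.
  The integrability condition says that the differences have finite energy; it is needed because
  the Bochner integral of a non-integrable function is \<open>0\<close>. The members are Borel representatives
  of the elements of the completion.\<close>

definition Ds :: "real \<Rightarrow> real \<Rightarrow> ('a::euclidean_space \<Rightarrow> real) set" where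
  "Ds c s = {w. w \<in> borel_measurable borel \<and>
     (\<exists>\<phi> :: nat \<Rightarrow> 'a \<Rightarrow> real. (\<forall>n. \<phi> n \<in> test_functions UNIV) \<and>
       (\<forall>n. integrable (lborel \<Otimes>\<^sub>M lborel)
              (energy_integrand s (\<lambda>x. \<phi> n x - w x) (\<lambda>x. \<phi> n x - w x))) \<and>
       (\<lambda>n. energy c s (\<lambda>x. \<phi> n x - w x) (\<lambda>x. \<phi> n x - w x)) \<longlonglongrightarrow> 0 \<and>
       (AE x in lborel. (\<lambda>n. \<phi> n x) \<longlonglongrightarrow> w x))}"

definition weak_solution ::
    "real \<Rightarrow> real \<Rightarrow> 'a::euclidean_space set \<Rightarrow> ('a \<Rightarrow> real) \<Rightarrow> ('a \<Rightarrow> real) \<Rightarrow> bool" where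
  "weak_solution c s U g w \<longleftrightarrow> w \<in> Ds c s \<and>
     (\<forall>\<phi> \<in> test_functions U. energy c s w \<phi> = (LINT x:U|lborel. g x * \<phi> x))"

definition holder_continuous :: "real \<Rightarrow> ('a::euclidean_space \<Rightarrow> real) \<Rightarrow> bool" where
  "holder_continuous s u \<longleftrightarrow> (\<exists>L. \<forall>x y. \<bar>u x - u y\<bar> \<le> L * norm (x - y) powr s)"

definition locally_lipschitz :: "(real \<Rightarrow> real) \<Rightarrow> bool" where
  "locally_lipschitz f \<longleftrightarrow> (\<forall>t. \<exists>\<epsilon>>0. \<exists>L. L-lipschitz_on (cball t \<epsilon>) f)"

definition radially_symmetric :: "'a::euclidean_space \<Rightarrow> ('a \<Rightarrow> real) \<Rightarrow> bool" where
  "radially_symmetric x0 u \<longleftrightarrow> (\<exists>g. \<forall>x. u x = g (norm (x - x0)))"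

definition radially_decreasing :: "'a::euclidean_space \<Rightarrow> real \<Rightarrow> ('a \<Rightarrow> real) \<Rightarrow> bool" where
  "radially_decreasing x0 \<rho> u \<longleftrightarrow>
     (\<forall>x y. x \<notin> cball x0 \<rho> \<longrightarrow> y \<notin> cball x0 \<rho> \<longrightarrow>
        norm (x - x0) < norm (y - x0) \<longrightarrow> u y < u x)"

end

theory Submission
  imports Defs
begin

text \<open>
  The proof is the method of moving planes, carried out pointwise. For a unit vector \<open>e\<close> and
  \<open>\<mu> > x0 \<bullet> e\<close> let \<open>R\<close> be the reflection in the hyperplane \<open>x \<bullet> e = \<mu>\<close>, let \<open>H\<close> be the half-space
  \<open>x \<bullet> e > \<mu>\<close>, and let \<open>w = u \<circ> R - u\<close>. Since \<open>R\<close> brings the points of \<open>H\<close> closer to \<open>x0\<close>, it maps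
  \<open>H \<inter> B\<close> into the ball \<open>B\<close>; where the reflected point lies in \<open>B\<close> one has \<open>w = a - u \<ge> 0\<close>, and
  elsewhere in \<open>H\<close> the antisymmetric function \<open>w\<close> solves \<open>(-\<Delta>)\<^sup>s w = f(u \<circ> R) - f(u)\<close>. The claim is
  that \<open>w \<ge> 0\<close> on \<open>H\<close>, with strict inequality outside \<open>B\<close>. Taking for the hyperplane the perpendicular
  bisector of two points at different distances from \<open>x0\<close>, the farther one outside \<open>B\<close>, this says that
  \<open>u\<close> is strictly larger at the nearer one; equality on spheres follows by continuity.

  Everything rests on what the equation says at a point \<open>z\<close> of \<open>H\<close> where \<open>w\<close> attains its minimum over
  \<open>H\<close>. Testing the weak equation with translates of a radial bump function gives, for the mollified
  function \<open>W\<close> and the kernel \<open>K(h) = |h|\<^sup>-\<^sup>N\<^sup>-\<^sup>2\<^sup>s\<close>, the identity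
  \<open>c/2 \<integral> K(h) (2 W(z) - W(z+h) - W(z-h)) dh = (mollified right-hand side at z)\<close>, in which no principal
  value occurs (\<open>weak_solution_mollified_eq\<close>). At a local minimum of the continuous function \<open>w\<close>
  itself, Fatou's lemma turns this into an inequality for \<open>w\<close> (\<open>local_min_inequality\<close>): the
  minimum bounds the second differences from one side, which is what Fatou's lemma requires. By
  antisymmetry the integral over the whole space folds to one with a nonnegative integrand
  (\<open>antisymmetric_min_representation\<close>). Two conclusions result
  (\<open>antisymmetric_min_principle\<close>). If \<open>w(z) < 0\<close> and \<open>d\<close> is the distance of \<open>z\<close> from the hyperplane,
  then \<open>f(u(R z)) - f(u(z)) \<le> c \<kappa> w(z) d\<^sup>-\<^sup>2\<^sup>s\<close> for a constant \<open>\<kappa> > 0\<close>. If \<open>w(z) = 0\<close> and the right-hand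
  side is nonnegative there, then \<open>w = 0\<close> on \<open>H\<close>.

  The first conclusion rules out a negative minimum where \<open>u\<close> is small, because there \<open>f\<close> is
  non-increasing; hence minimum points stay in a bounded set, and \<open>w \<ge> 0\<close> for large \<open>\<mu>\<close>. Let \<open>\<Lambda>\<close> be
  the supremum of the positions for which \<open>w \<ge> 0\<close> fails, and take negative minimum points for positions
  tending to \<open>\<Lambda>\<close>. They accumulate at some point. On the hyperplane this is impossible, as
  \<open>d\<^sup>-\<^sup>2\<^sup>s\<close> blows up while \<open>f\<close> is Lipschitz near the limiting value of \<open>u\<close>. Off the hyperplane the limit
  is a zero of \<open>w\<close> at position \<open>\<Lambda>\<close>, so that \<open>w\<close> vanishes on \<open>H\<close> by the second conclusion; but \<open>u = a\<close> on
  \<open>B\<close> and \<open>u < a\<close> outside \<open>B\<close>, so \<open>u\<close> is not symmetric about a hyperplane that misses \<open>x0\<close>.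

  The strict bound \<open>u < a\<close> outside \<open>B\<close>, and the bound \<open>u \<le> a\<close> in the second part of the theorem, come
  from the same pointwise inequality applied to \<open>-u\<close>: at a positive global maximum outside \<open>B\<close> the
  right-hand side \<open>f(u)\<close> must be positive (\<open>source_pos_at_exterior_max\<close>).
\<close>

section \<open>Lebesgue measure\<close>

lemma AE_notin_open_imp_empty:
  fixes S :: "'a::euclidean_space set"
  assumes "open S" "AE x in lborel. x \<notin> S" shows "S = {}"
proof (rule ccontr)
  assume "S \<noteq> {}"
  then obtain x r where xr: "0 < r" "ball x r \<subseteq> S"
    using \<open>open S\<close> by (meson open_contains_ball ex_in_conv)
  have "S \<in> null_sets lborel"
    using assms AE_iff_null[of lborel "\<lambda>x. x \<notin> S"] by simp
  then have "ball x r \<in> null_sets lborel" by (rule null_sets_subset) (use xr in auto)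
  then show False using xr(1) emeasure_ball[of r x] unit_ball_vol_pos[of "DIM('a)"]
    by (auto simp: null_sets_def)
qed

lemma lborel_shift:
  fixes f :: "'a::euclidean_space \<Rightarrow> 'b::{banach, second_countable_topology}"
  assumes [measurable]: "f \<in> borel_measurable borel"
  shows integral_lborel_shift: "(\<integral>x. f (c + x) \<partial>lborel) = (\<integral>x. f x \<partial>lborel)"
    and integrable_lborel_shift: "integrable lborel (\<lambda>x. f (c + x)) \<longleftrightarrow> integrable lborel f"
  by (subst (2) lborel_distr_plus[of c, symmetric], subst integral_distr; simp)
     (subst (2) lborel_distr_plus[of c, symmetric], subst integrable_distr_eq; simp)

lemma nn_integral_lborel_shift:
  fixes f :: "'a::euclidean_space \<Rightarrow> ennreal"
  assumes [measurable]: "f \<in> borel_measurable borel"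
  shows "(\<integral>\<^sup>+x. f (c + x) \<partial>lborel) = (\<integral>\<^sup>+x. f x \<partial>lborel)"
  by (subst (2) lborel_distr_plus[of c, symmetric], subst nn_integral_distr; simp)

lemma integrable_compact_support:
  fixes f :: "'a::euclidean_space \<Rightarrow> real"
  assumes "compact S" "continuous_on UNIV f" "\<And>x. x \<notin> S \<Longrightarrow> f x = 0"
  shows "integrable lborel f"
proof -
  have "(\<lambda>x. indicator S x *\<^sub>R f x) = f" using assms(3) by (auto simp: indicator_def fun_eq_iff)
  then show ?thesis
    using borel_integrable_compact[OF assms(1) continuous_on_subset[OF assms(2)]] by auto
qed

text \<open>The image measure \<open>\<mu>\<close> of Lebesgue measure \<open>\<lambda>\<close> under \<open>Q\<close> is translation invariant, and so is \<open>\<lambda>\<close>. For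
  two such measures, evaluating the double integral of \<open>f(x + y) \<beta>(y)\<close> in both orders yields
  \<open>(\<integral>f d\<lambda>)(\<integral>\<beta> d\<mu>) = (\<integral>f d\<mu>)(\<integral>\<beta>(-x) d\<lambda>)\<close>. With \<open>\<beta>\<close> the indicator of the unit ball, which \<open>Q\<close> preserves,
  the two factors with \<open>\<beta>\<close> are equal, positive and finite, and cancel.\<close>

lemma distr_lborel_isometric_involution:
  fixes Q :: "'a::euclidean_space \<Rightarrow> 'a"
  assumes lin: "linear Q" and norm: "\<And>x. norm (Q x) = norm x" and inv: "\<And>x. Q (Q x) = x"
  shows "distr lborel borel Q = lborel"
proof -
  have [measurable]: "Q \<in> borel_measurable borel"
    using linear_continuous_on[of Q UNIV] lin by (intro borel_measurable_continuous_onI) (simp add: linear_conv_bounded_linear)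
  define \<beta> :: "'a \<Rightarrow> ennreal" where "\<beta> = indicator (ball 0 1)"
  have [measurable]: "\<beta> \<in> borel_measurable borel" unfolding \<beta>_def by (intro borel_measurable_indicator) simp
  define V where "V = (\<integral>\<^sup>+x. \<beta> x \<partial>lborel)"
  have V: "V \<noteq> 0" "V \<noteq> \<infinity>"
    using emeasure_ball[of 1 "0::'a"] less_imp_neq[OF unit_ball_vol_pos[of "real DIM('a)"]]
    by (auto simp: V_def \<beta>_def)
  have main: "(\<integral>\<^sup>+x. f (Q x) \<partial>lborel) = (\<integral>\<^sup>+x. f x \<partial>lborel)"
    if [measurable]: "f \<in> borel_measurable borel" for f :: "'a \<Rightarrow> ennreal"
  proof -
    have "V * (\<integral>\<^sup>+x. f x \<partial>lborel) = (\<integral>\<^sup>+y. \<beta> y * (\<integral>\<^sup>+x. f x \<partial>lborel) \<partial>lborel)"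
      unfolding V_def by (rule nn_integral_multc[symmetric]) simp
    also have "\<dots> = (\<integral>\<^sup>+y. \<beta> y * (\<integral>\<^sup>+x. f (Q y + x) \<partial>lborel) \<partial>lborel)"
      by (simp add: nn_integral_lborel_shift)
    also have "\<dots> = (\<integral>\<^sup>+y. \<integral>\<^sup>+x. \<beta> y * f (Q y + x) \<partial>lborel \<partial>lborel)"
      by (intro nn_integral_cong nn_integral_cmult[symmetric]) measurable
    also have "\<dots> = (\<integral>\<^sup>+x. \<integral>\<^sup>+y. \<beta> y * f (Q y + x) \<partial>lborel \<partial>lborel)"
      by (rule lborel_pair.Fubini') measurable
    also have "\<dots> = (\<integral>\<^sup>+x. \<integral>\<^sup>+y. \<beta> (- Q x + y) * f (Q (- Q x + y) + x) \<partial>lborel \<partial>lborel)"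
      by (intro nn_integral_cong nn_integral_lborel_shift[symmetric]) measurable
    also have "\<dots> = (\<integral>\<^sup>+x. \<integral>\<^sup>+y. \<beta> (- Q y + x) * f (Q y) \<partial>lborel \<partial>lborel)"
    proof -
      have "Q (- Q x + y) + x = Q y" for x y
        using lin by (simp add: linear_diff linear_add linear_neg inv)
      moreover have "\<beta> (- Q x + y) = \<beta> (- Q y + x)" for x y
      proof -
        have "norm (- Q x + y) = norm (Q (- Q x + y))" by (simp add: norm)
        also have "\<dots> = norm (- Q y + x)"
          using lin by (simp add: linear_diff linear_add linear_neg inv norm_minus_commute)
        finally show ?thesis by (simp add: \<beta>_def indicator_def)
      qed
      ultimately show ?thesis by simp
    qed
    also have "\<dots> = (\<integral>\<^sup>+y. \<integral>\<^sup>+x. \<beta> (- Q y + x) * f (Q y) \<partial>lborel \<partial>lborel)"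
      by (rule lborel_pair.Fubini') measurable
    also have "\<dots> = (\<integral>\<^sup>+y. (\<integral>\<^sup>+x. \<beta> (- Q y + x) \<partial>lborel) * f (Q y) \<partial>lborel)"
      by (intro nn_integral_cong nn_integral_multc) measurable
    also have "\<dots> = (\<integral>\<^sup>+y. V * f (Q y) \<partial>lborel)"
      by (simp add: nn_integral_lborel_shift V_def del: uminus_add_conv_diff)
    also have "\<dots> = V * (\<integral>\<^sup>+y. f (Q y) \<partial>lborel)"
      by (rule nn_integral_cmult) measurable
    finally show ?thesis using V by (simp add: ennreal_mult_cancel_left)
  qed
  show ?thesis
  proof (rule measure_eqI)
    fix A assume "A \<in> sets (distr lborel borel Q)"
    then have [measurable]: "A \<in> sets borel" by simp
    show "emeasure (distr lborel borel Q) A = emeasure lborel A"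
      using main[of "indicator A"] by (subst nn_integral_indicator[symmetric], simp, subst nn_integral_distr) auto
  qed simp
qed

section \<open>Smooth bump functions\<close>

lemma power_le_fact_exp: "0 \<le> x \<Longrightarrow> x ^ n \<le> fact n * exp (x::real)"
proof -
  assume x: "0 \<le> x"
  have "x ^ n / fact n \<le> (\<Sum>k. x ^ k / fact k)"
    using sum_le_suminf[OF summable_exp[of x], of "{n}"] x by (simp add: divide_inverse mult.commute)
  also have "\<dots> = exp x" by (simp add: exp_def divide_inverse mult.commute)
  finally show ?thesis by (simp add: field_simps)
qed

text \<open>For fixed \<open>k\<close> these functions are all flat at \<open>0\<close>, and their derivatives are again linear
  combinations of functions of the family. That is why the negative powers of \<open>t\<close> are included: the
  induction on the order of differentiability then stays inside the family.\<close>

definition flat :: "nat \<Rightarrow> real \<Rightarrow> real" where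
  "flat k t = (if t > 0 then exp (- (1 / t)) / t ^ k else 0)"

lemma flat_nonneg: "0 \<le> flat k t" by (simp add: flat_def)

lemma flat_le_square: "flat k t \<le> fact (k + 2) * t\<^sup>2"
proof (cases "t > 0")
  case True
  have "(1 / t) ^ (k + 2) \<le> fact (k + 2) * exp (1 / t)" by (rule power_le_fact_exp) (use True in auto)
  then have "exp (- (1 / t)) * (1/t) ^ (k+2) \<le> exp (- (1 / t)) * (fact (k + 2) * exp (1 / t))"
    by (rule mult_left_mono) simp
  also have "\<dots> = fact (k + 2)" by (simp add: exp_minus)
  finally have "exp (- (1 / t)) * (1/t) ^ (k+2) \<le> fact (k + 2)" .
  then show ?thesis using True
    by (simp add: flat_def field_simps power_add power2_eq_square del: fact_Suc)
qed (auto simp: flat_def)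

lemma flat_has_derivative:
  "(flat k has_real_derivative flat (k + 2) t - real k * flat (k + 1) t) (at t)"
proof -
  consider "t > 0" | "t < 0" | "t = 0" by linarith
  then show ?thesis
  proof cases
    case 1
    have "((\<lambda>t. exp (- (1 / t)) / t ^ k) has_real_derivative flat (k + 2) t - real k * flat (k + 1) t) (at t)"
      apply (rule derivative_eq_intros refl | use 1 in simp; fail)+
      using 1 apply (cases k) apply (auto simp: flat_def field_simps power2_eq_square)
      done
    then show ?thesis
      by (rule DERIV_cong_ev[THEN iffD1, rotated -1])
         (use 1 eventually_nhds_in_open[of "{0<..}" t] in \<open>auto simp: flat_def elim!: eventually_mono\<close>)
  next
    case 2
    have "((\<lambda>t. 0) has_real_derivative flat (k + 2) t - real k * flat (k + 1) t) (at t)"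
      using 2 by (simp add: flat_def)
    then show ?thesis
      by (rule DERIV_cong_ev[THEN iffD1, rotated -1])
         (use 2 eventually_nhds_in_open[of "{..<0}" t] in \<open>auto simp: flat_def elim!: eventually_mono\<close>)
  next
    case 3
    have "((\<lambda>h. flat k h / h) \<longlongrightarrow> 0) (at 0)"
    proof (rule Lim_null_comparison)
      show "eventually (\<lambda>h. norm (flat k h / h) \<le> fact (k + 2) * \<bar>h\<bar>) (at 0)"
      proof (unfold eventually_at_topological, intro exI[of _ UNIV] conjI ballI impI)
        fix h :: real assume h: "h \<noteq> 0"
        have "flat k h / \<bar>h\<bar> \<le> fact (k + 2) * h\<^sup>2 / \<bar>h\<bar>"
          by (intro divide_right_mono flat_le_square) auto
        also have "\<dots> = fact (k + 2) * \<bar>h\<bar>" using h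
          by (simp add: power2_eq_square divide_simps abs_mult_self_eq del: fact_Suc)
        finally show "norm (flat k h / h) \<le> fact (k + 2) * \<bar>h\<bar>"
          by (simp add: flat_nonneg abs_divide del: fact_Suc)
      qed auto
      show "((\<lambda>h. fact (k + 2) * \<bar>h\<bar>) \<longlongrightarrow> (0::real)) (at 0)"
        by (auto intro!: tendsto_eq_intros simp del: fact_Suc)
    qed
    then show ?thesis using 3 by (simp add: has_field_derivative_iff flat_def)
  qed
qed

lemma Ck_Suc_imp: "Ck (Suc n) \<phi> \<Longrightarrow> Ck n \<phi>"
proof (induction n arbitrary: \<phi>)
  case 0
  then show ?case
    by (auto intro!: continuous_at_imp_continuous_on differentiable_imp_continuous_within)
next
  case (Suc n)
  then show ?case by (metis Ck.simps(2))
qed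

lemma Ck_const: "Ck n (\<lambda>x. c)"
  by (induction n arbitrary: c) (auto simp: frechet_derivative_const)

lemma Ck_add: "Ck n f \<Longrightarrow> Ck n g \<Longrightarrow> Ck n (\<lambda>x. f x + g x)"
proof (induction n arbitrary: f g)
  case 0
  then show ?case by (auto intro!: continuous_intros)
next
  case (Suc n)
  have "frechet_derivative (\<lambda>x. f x + g x) (at x) = (\<lambda>h. frechet_derivative f (at x) h + frechet_derivative g (at x) h)" for x
    using Suc.prems by (intro frechet_derivative_at[symmetric] has_derivative_add)
      (auto simp: frechet_derivative_works)
  then show ?case using Suc by auto
qed

lemma Ck_mult: "Ck n f \<Longrightarrow> Ck n g \<Longrightarrow> Ck n (\<lambda>x. f x * g x)"
proof (induction n arbitrary: f g)
  case 0
  then show ?case by (auto intro!: continuous_intros)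
next
  case (Suc n)
  have "frechet_derivative (\<lambda>x. f x * g x) (at x) = (\<lambda>h. f x * frechet_derivative g (at x) h + frechet_derivative f (at x) h * g x)" for x
    using Suc.prems has_derivative_mult[of f "frechet_derivative f (at x)" x UNIV g "frechet_derivative g (at x)"]
    by (auto intro!: frechet_derivative_at[symmetric] simp: frechet_derivative_works)
  then show ?case using Suc.prems Suc.IH Ck_Suc_imp[OF Suc.prems(1)] Ck_Suc_imp[OF Suc.prems(2)]
    by (auto intro!: Ck_add)
qed

lemma Ck_inner: "Ck n (\<lambda>x. (x - z) \<bullet> h)"
proof (induction n)
  case (Suc n)
  have "((\<lambda>x. (x - z) \<bullet> h) has_derivative (\<lambda>k. k \<bullet> h)) (at x)" for x
    by (auto intro!: derivative_eq_intros)
  then have "frechet_derivative (\<lambda>x. (x - z) \<bullet> h) (at x) = (\<lambda>k. k \<bullet> h)" "(\<lambda>x. (x - z) \<bullet> h) differentiable (at x)" for x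
    by (auto intro: frechet_derivative_at[symmetric] simp: differentiable_def)
  then show ?case by (simp add: Ck_const)
qed (auto intro!: continuous_intros)

text \<open>By the chain rule a directional derivative is a sum of products of functions of the same kind, of
  constants and of the affine function \<open>(x - z) \<bullet> h\<close>; the induction hypothesis, for all \<open>k\<close>,
  applies to them.\<close>

lemma Ck_flat_sphere: "Ck n (\<lambda>x. flat k (r - (x - z) \<bullet> (x - z)))"
proof (induction n arbitrary: k)
  case 0
  have "continuous_on UNIV (flat k)"
    by (intro continuous_at_imp_continuous_on ballI DERIV_isCont[OF flat_has_derivative])
  then show ?case
    by (auto intro!: continuous_intros continuous_on_compose2[of UNIV "flat k"])
next
  case (Suc n)
  define q where "q = (\<lambda>x. r - (x - z) \<bullet> (x - z))"
  have D: "((\<lambda>x. flat k (q x)) has_derivative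
      (\<lambda>h. (flat (k + 2) (q x) + (- real k) * flat (k + 1) (q x)) * (- 2 * ((x - z) \<bullet> h)))) (at x)" for x
  proof -
    have "(q has_derivative (\<lambda>h. - 2 * ((x - z) \<bullet> h))) (at x)"
      unfolding q_def by (auto intro!: derivative_eq_intros simp: inner_commute)
    from DERIV_compose_FDERIV[OF flat_has_derivative this]
    show ?thesis by (simp add: mult.commute)
  qed
  then have "frechet_derivative (\<lambda>x. flat k (q x)) (at x) =
      (\<lambda>h. (flat (k + 2) (q x) + (- real k) * flat (k + 1) (q x)) * (- 2 * ((x - z) \<bullet> h)))" for x
    by (rule frechet_derivative_at[symmetric])
  moreover have "(\<lambda>x. flat k (q x)) differentiable (at x)" for x
    using D by (auto simp: differentiable_def)
  moreover have "Ck n (\<lambda>x. (flat (k + 2) (q x) + (- real k) * flat (k + 1) (q x)) * (- 2 * ((x - z) \<bullet> h)))" for h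
    using Suc by (intro Ck_mult Ck_add Ck_const Ck_inner) (auto simp: q_def)
  ultimately have "Ck (Suc n) (\<lambda>x. flat k (q x))" by simp
  then show ?case by (simp add: q_def)
qed

definition bump :: "real \<Rightarrow> 'a::euclidean_space \<Rightarrow> real" where
  "bump \<epsilon> x = flat 0 (\<epsilon>\<^sup>2 - x \<bullet> x)"

lemma bump_eq_0: "0 \<le> \<epsilon> \<Longrightarrow> \<epsilon> \<le> norm x \<Longrightarrow> bump \<epsilon> x = 0"
  by (auto simp: bump_def flat_def power2_norm_eq_inner[symmetric] dest: power_mono[where n = 2])

lemma bump_pos: "norm x < \<epsilon> \<Longrightarrow> bump \<epsilon> x > 0"
  by (auto simp: bump_def flat_def power2_norm_eq_inner[symmetric] power_strict_mono)

lemma bump_nonneg: "0 \<le> bump \<epsilon> x"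
  by (simp add: bump_def flat_nonneg)

lemma bump_le_1: "bump \<epsilon> x \<le> 1"
  by (simp add: bump_def flat_def)

lemma Ck_bump: "Ck n (\<lambda>x. bump \<epsilon> (x - z))"
  unfolding bump_def by (rule Ck_flat_sphere)

lemma continuous_bump: "continuous_on UNIV (bump \<epsilon>)"
  using Ck_bump[of 0 \<epsilon> 0] by simp

lemma flat_0_lipschitz: "\<bar>flat 0 t - flat 0 t'\<bar> \<le> 2 * \<bar>t - t'\<bar>"
proof -
  have "flat 2 x \<le> 2" for x
    using power_le_fact_exp[of "1/x" 2] by (auto simp: flat_def exp_minus divide_simps)
  then show ?thesis
    using field_differentiable_bound[of UNIV "flat 0" "flat 2" 2 t t'] flat_has_derivative[of 0]
    by (auto simp: flat_nonneg numeral_2_eq_2)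
qed

text \<open>Near the support the argument of \<open>flat 0\<close> is Lipschitz in \<open>x\<close>, and far away the trivial bound \<open>1\<close>
  suffices. The truncated form is what makes the double integrals of the weak equation converge at
  infinity as well as near the diagonal.\<close>

lemma bump_modulus:
  assumes "\<epsilon> > 0"
  shows "\<bar>bump \<epsilon> x - bump \<epsilon> y\<bar> \<le> (4 * \<epsilon> + 4) * min 1 (norm (x - y))"
proof -
  have main: "\<bar>bump \<epsilon> x - bump \<epsilon> y\<bar> \<le> (4 * \<epsilon> + 4) * min 1 (norm (x - y))" if "norm x \<le> \<epsilon>" for x y :: 'a
  proof (cases "norm (x - y) \<le> 1")
    case True
    have "\<bar>bump \<epsilon> x - bump \<epsilon> y\<bar> \<le> 2 * \<bar>y \<bullet> y - x \<bullet> x\<bar>"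
      using flat_0_lipschitz[of "\<epsilon>\<^sup>2 - x \<bullet> x" "\<epsilon>\<^sup>2 - y \<bullet> y"] by (simp add: bump_def)
    also have "y \<bullet> y - x \<bullet> x = (y - x) \<bullet> (x + y)" by (simp add: algebra_simps inner_commute)
    also have "\<bar>(y - x) \<bullet> (x + y)\<bar> \<le> norm (y - x) * norm (x + y)" by (rule Cauchy_Schwarz_ineq2)
    also have "norm (x + y) \<le> 2 * \<epsilon> + 1"
    proof -
      have "x + y = 2 *\<^sub>R x - (x - y)" by (simp add: scaleR_2)
      then have "norm (x + y) \<le> norm (2 *\<^sub>R x) + norm (x - y)" by (metis norm_triangle_ineq4)
      then show ?thesis using that True by simp
    qed
    finally have "\<bar>bump \<epsilon> x - bump \<epsilon> y\<bar> \<le> 2 * (norm (y - x) * (2 * \<epsilon> + 1))" by (simp add: mult_left_mono)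
    also have "\<dots> \<le> (4 * \<epsilon> + 4) * norm (x - y)"
      by (simp add: norm_minus_commute algebra_simps)
    finally show ?thesis using True by (simp add: min_def)
  next
    case False
    then show ?thesis using bump_nonneg[of \<epsilon> x] bump_nonneg[of \<epsilon> y] bump_le_1[of \<epsilon> x] bump_le_1[of \<epsilon> y] assms
      by (simp add: min_def)
  qed
  consider "norm x \<le> \<epsilon>" | "norm y \<le> \<epsilon>" | "\<epsilon> < norm x" "\<epsilon> < norm y" by linarith
  then show ?thesis
  proof cases
    case 2 then show ?thesis using main[of y x] by (simp add: norm_minus_commute abs_minus_commute)
  next
    case 3 then show ?thesis using assms by (simp add: bump_eq_0)
  qed (rule main)
qed

definition mollifier :: "real \<Rightarrow> 'a::euclidean_space \<Rightarrow> real" where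
  "mollifier \<epsilon> x = bump \<epsilon> x / (\<integral>y. bump \<epsilon> (y::'a) \<partial>lborel)"

lemma integral_bump_pos:
  assumes "\<epsilon> > 0" shows "(\<integral>y. bump \<epsilon> (y::'a::euclidean_space) \<partial>lborel) > 0"
proof -
  have i: "integrable lborel (bump \<epsilon> :: 'a \<Rightarrow> real)"
    by (rule integrable_compact_support[of "cball 0 \<epsilon>"]) (use assms continuous_bump in \<open>auto simp: bump_eq_0\<close>)
  have "(\<integral>y. bump \<epsilon> (y::'a) \<partial>lborel) \<noteq> 0"
  proof
    assume "(\<integral>y. bump \<epsilon> (y::'a) \<partial>lborel) = 0"
    then have "AE x in lborel. bump \<epsilon> (x::'a) = 0"
      using integral_nonneg_eq_0_iff_AE[OF i] by (simp add: bump_nonneg)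
    then have "AE x in lborel. x \<notin> ball (0::'a) \<epsilon>"
      by eventually_elim (use bump_pos[of _ \<epsilon>] in force)
    then have "ball (0::'a) \<epsilon> = {}" by (rule AE_notin_open_imp_empty[OF open_ball])
    then show False using assms by simp
  qed
  then show ?thesis using Bochner_Integration.integral_nonneg[of lborel "bump \<epsilon> :: 'a \<Rightarrow> real"] bump_nonneg by (metis order_le_less)
qed

context fixes \<epsilon> :: real assumes \<epsilon>: "\<epsilon> > 0" begin

lemma mollifier_nonneg: "0 \<le> mollifier \<epsilon> x"
  using integral_bump_pos[OF \<epsilon>] by (simp add: mollifier_def bump_nonneg less_imp_le)

lemma mollifier_eq_0: "\<epsilon> \<le> norm x \<Longrightarrow> mollifier \<epsilon> x = 0"
  using \<epsilon> by (simp add: mollifier_def bump_eq_0)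

lemma mollifier_norm_cong: "norm (x::'a::euclidean_space) = norm (y::'a) \<Longrightarrow> mollifier \<epsilon> x = mollifier \<epsilon> y"
  by (simp only: mollifier_def bump_def power2_norm_eq_inner[symmetric])

lemma continuous_mollifier: "continuous_on UNIV (mollifier \<epsilon>)"
  by (auto simp: mollifier_def[abs_def] less_imp_neq[OF integral_bump_pos[OF \<epsilon>], symmetric]
      intro!: continuous_intros continuous_bump)

lemma mollifier_measurable [measurable]: "mollifier \<epsilon> \<in> borel_measurable borel"
  by (rule borel_measurable_continuous_onI[OF continuous_mollifier])

lemma mollifier_modulus:
  obtains C where "0 \<le> C" "\<And>x y::'a::euclidean_space. \<bar>mollifier \<epsilon> x - mollifier \<epsilon> y\<bar> \<le> C * min 1 (norm (x - y))"
proof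
  let ?I = "\<integral>y. bump \<epsilon> (y::'a) \<partial>lborel"
  show "0 \<le> (4 * \<epsilon> + 4) / ?I" using integral_bump_pos[OF \<epsilon>, where 'a = 'a] \<epsilon> by simp
  show "\<bar>mollifier \<epsilon> x - mollifier \<epsilon> y\<bar> \<le> (4 * \<epsilon> + 4) / ?I * min 1 (norm (x - y))" for x y :: 'a
    using divide_right_mono[OF bump_modulus[OF \<epsilon>, of x y], of ?I] integral_bump_pos[OF \<epsilon>, where 'a = 'a]
    by (simp add: mollifier_def diff_divide_distrib[symmetric])
qed

lemma mollifier_test_function:
  assumes "cball z \<epsilon> \<subseteq> U"
  shows "(\<lambda>x. mollifier \<epsilon> (x - z)) \<in> test_functions U"
proof -
  have "{x. mollifier \<epsilon> (x - z) \<noteq> 0} \<subseteq> cball z \<epsilon>"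
  proof
    fix x assume "x \<in> {x. mollifier \<epsilon> (x - z) \<noteq> 0}"
    then have "\<not> \<epsilon> \<le> norm (x - z)" using mollifier_eq_0 by auto
    then show "x \<in> cball z \<epsilon>" by (simp add: dist_norm norm_minus_commute)
  qed
  then have "closure {x. mollifier \<epsilon> (x - z) \<noteq> 0} \<subseteq> cball z \<epsilon>"
    by (rule closure_minimal) simp
  moreover have "Ck n (\<lambda>x. mollifier \<epsilon> (x - z))" for n
    using Ck_mult[OF Ck_const Ck_bump, of n "1 / (\<integral>y. bump \<epsilon> (y::'a) \<partial>lborel)" \<epsilon> z] by (simp add: mollifier_def)
  ultimately show ?thesis using assms
    by (auto simp: test_functions_def compact_eq_bounded_closed intro: bounded_subset[OF bounded_cball])
qed

lemma integrable_mult_mollifier: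
  assumes "continuous_on UNIV g"
  shows "integrable lborel (\<lambda>x. g x * mollifier \<epsilon> (x - z))"
proof (rule integrable_compact_support[of "cball z \<epsilon>"])
  show "continuous_on UNIV (\<lambda>x. g x * mollifier \<epsilon> (x - z))"
    using assms by (intro continuous_intros continuous_on_compose2[OF continuous_mollifier]) auto
  show "g x * mollifier \<epsilon> (x - z) = 0" if "x \<notin> cball z \<epsilon>" for x
    using that mollifier_eq_0[of "x - z"] by (simp add: dist_norm norm_minus_commute)
qed auto

lemma integral_mollifier: "(\<integral>x. mollifier \<epsilon> x \<partial>lborel) = 1"
  by (simp add: mollifier_def less_imp_neq[OF integral_bump_pos[OF \<epsilon>], symmetric])

end

section \<open>The kernel of the fractional Laplacian\<close>

text \<open>The kernel \<open>|h|\<^sup>-\<^sup>N\<^sup>-\<^sup>2\<^sup>s\<close>. At the origin its value is \<open>1 / 0 = 0\<close>, so monotonicity in \<open>|h|\<close> holds only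
  away from the origin.\<close>

definition kern :: "real \<Rightarrow> 'a::euclidean_space \<Rightarrow> real" where
  "kern s h = 1 / norm h powr (real DIM('a) + 2 * s)"

text \<open>Comparison with a sum over dyadic balls. On the annulus of radius about \<open>2\<^sup>-\<^sup>k\<close> the integral is at most
  a multiple of \<open>2\<^sup>-\<^sup>k\<^sup>(\<^sup>p\<^sup>-\<^sup>q\<^sup>)\<close>, and on the annulus of radius about \<open>2\<^sup>k\<close> at most a multiple of \<open>2\<^sup>-\<^sup>k\<^sup>q\<close>.
  Both are terms of convergent geometric series. The exponent \<open>p = 1\<close> serves the weak equation, in which
  one of the two factors is Lipschitz and the other one Hoelder continuous; \<open>p = 2\<close> serves second
  differences.\<close>

lemma integrable_truncated_power:
  fixes p q :: real
  assumes "0 < q" "q < p"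
  shows "integrable lborel (\<lambda>h::'a::euclidean_space. min 1 (norm h powr p) / norm h powr (real DIM('a) + q))"
proof -
  let ?N = "real DIM('a)"
  let ?f = "\<lambda>h::'a. min 1 (norm h powr p) / norm h powr (?N + q)"
  define b :: "nat \<Rightarrow> real" where "b k = 2 powr (- real k)" for k
  define B :: "nat \<Rightarrow> real" where "B k = 2 powr real k" for k
  define V where "V = unit_ball_vol ?N"
  have V: "0 \<le> V" by (simp add: V_def unit_ball_vol_nonneg)
  define C where "C k = b k powr p / b (Suc k) powr (?N + q)" for k
  define D where "D k = 1 / B k powr (?N + q)" for k
  let ?g = "\<lambda>k h. ennreal (C k) * indicator (ball 0 (b k)) h + ennreal (D k) * indicator (ball 0 (B (Suc k))) (h::'a)"
  have bound: "ennreal (?f h) \<le> (\<Sum>k. ?g k h)" for h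
  proof -
    have one: "ennreal (?f h) \<le> (\<Sum>k. ?g k h)" if "ennreal (?f h) \<le> ?g k h" for k
      using that sum_le_suminf[of "\<lambda>k. ?g k h" "{k}"] by (auto intro: order_trans)
    consider "h = 0" | "0 < norm h" "norm h < 1" | "1 \<le> norm h" by fastforce
    then show ?thesis
    proof cases
      case 1 then show ?thesis by simp
    next
      case 2
      \<comment> \<open>\<open>norm h\<close> lies in the annulus with radii \<open>2\<^sup>-\<^sup>(\<^sup>k\<^sup>+\<^sup>1\<^sup>)\<close> and \<open>2\<^sup>-\<^sup>k\<close>.\<close>
      define x where "x = - log 2 (norm h)"
      have x: "0 < x" "norm h = 2 powr (- x)" using 2 by (auto simp: x_def log_less_zero_cancel_iff)
      define k where "k = nat (\<lceil>x\<rceil> - 1)"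
      have k: "real k < x" "x \<le> real (Suc k)" using x(1) unfolding k_def by linarith+
      have h: "norm h < b k" "b (Suc k) \<le> norm h" using k unfolding b_def x(2) by auto
      have "?f h \<le> norm h powr p / norm h powr (?N + q)" by (intro divide_right_mono) auto
      also have "\<dots> \<le> C k" unfolding C_def using h 2 assms
        by (intro frac_le powr_mono2) (auto simp: b_def)
      finally show ?thesis using h by (intro one[of k]) (auto simp: ennreal_leI intro!: add_increasing2)
    next
      case 3
      define x where "x = log 2 (norm h)"
      have x: "0 \<le> x" "norm h = 2 powr x" using 3 order.strict_trans2[OF zero_less_one 3]
        by (simp_all only: x_def powr_log_cancel) simp_all
      define k where "k = nat \<lfloor>x\<rfloor>"
      have k: "real k \<le> x" "x < real (Suc k)" using x(1) unfolding k_def by linarith+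
      have h: "B k \<le> norm h" "norm h < B (Suc k)" using k unfolding B_def x(2) by auto
      have "?f h \<le> 1 / norm h powr (?N + q)" by (intro divide_right_mono) auto
      also have "\<dots> \<le> D k" unfolding D_def using h 3 assms
        by (intro frac_le powr_mono2) (auto simp: B_def)
      finally show ?thesis using h by (intro one[of k]) (auto simp: ennreal_leI intro!: add_increasing)
    qed
  qed
  have [measurable]: "ball (0::'a) r \<in> sets borel" for r by simp
  have vol: "emeasure lborel (ball (0::'a) r) = ennreal (V * r powr ?N)" if "0 < r" for r
    using that by (simp add: emeasure_ball V_def powr_realpow)
  have pw: "(2 powr x) ^ k = (2::real) powr (x * real k)" for x k
    by (simp add: powr_realpow[symmetric] powr_powr)
  have eC: "C k * (V * b k powr ?N) = V * 2 powr (?N + q) * (2 powr (q - p)) ^ k" for k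
  proof -
    have "C k * (V * b k powr ?N) = V * (2 powr (- real k * p - - real (Suc k) * (?N + q)) * 2 powr (- real k * ?N))"
      by (simp only: C_def b_def powr_powr powr_diff mult.left_commute)
    also have "\<dots> = V * 2 powr (?N + q + (q - p) * real k)"
      unfolding powr_add[symmetric] by (rule arg_cong[where f = "\<lambda>x. V * 2 powr x"]) (simp add: algebra_simps)
    finally show ?thesis by (simp only: powr_add pw mult.assoc)
  qed
  have eD: "D k * (V * B (Suc k) powr ?N) = V * 2 powr ?N * (2 powr (- q)) ^ k" for k
  proof -
    have "D k * (V * B (Suc k) powr ?N) = V * (2 powr (- (real k * (?N + q))) * 2 powr (real (Suc k) * ?N))"
      by (simp only: D_def B_def powr_powr powr_minus_divide mult.left_commute)
    also have "\<dots> = V * 2 powr (?N + (- q) * real k)"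
      unfolding powr_add[symmetric] by (rule arg_cong[where f = "\<lambda>x. V * 2 powr x"]) (simp add: algebra_simps)
    finally show ?thesis by (simp only: powr_add pw mult.assoc)
  qed
  have small: "2 powr (q - p) < 1" "2 powr (- q) < 1" using assms by (auto intro: powr_less_one)
  have s1: "summable (\<lambda>k. V * 2 powr (?N + q) * (2 powr (q - p)) ^ k)"
    using small by (intro summable_mult summable_geometric) auto
  have s2: "summable (\<lambda>k. V * 2 powr ?N * (2 powr (- q)) ^ k)"
    using small by (intro summable_mult summable_geometric) auto
  have "(\<integral>\<^sup>+h. ennreal (?f h) \<partial>lborel) \<le> (\<integral>\<^sup>+h. (\<Sum>k. ?g k h) \<partial>lborel)"
    by (intro nn_integral_mono bound)
  also have "\<dots> = (\<Sum>k. \<integral>\<^sup>+h. ?g k h \<partial>lborel)"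
    by (intro nn_integral_suminf) measurable
  also have "\<dots> = (\<Sum>k. ennreal (C k * (V * b k powr ?N) + D k * (V * B (Suc k) powr ?N)))"
  proof (intro arg_cong[where f = suminf] ext)
    fix k
    have "0 < b k" "0 < B (Suc k)" "0 \<le> C k" "0 \<le> D k" by (auto simp: b_def B_def C_def D_def)
    then show "(\<integral>\<^sup>+h. ?g k h \<partial>lborel) = ennreal (C k * (V * b k powr ?N) + D k * (V * B (Suc k) powr ?N))"
      using V by (simp add: nn_integral_add nn_integral_cmult vol ennreal_mult ennreal_plus)
  qed
  also have "\<dots> = ennreal (\<Sum>k. C k * (V * b k powr ?N) + D k * (V * B (Suc k) powr ?N))"
    unfolding eC eD using V s1 s2 by (intro suminf_ennreal2 summable_add) auto
  also have "\<dots> < \<infinity>" by simp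
  finally show ?thesis by (intro integrableI_nonneg) auto
qed

lemma kern_nonneg: "0 \<le> kern s h" by (simp add: kern_def)

lemma kern_measurable [measurable]: "kern s \<in> borel_measurable borel"
  unfolding kern_def by measurable

lemma kern_norm_cong: "norm (x::'a::euclidean_space) = norm (y::'a) \<Longrightarrow> kern s x = kern s y"
  by (simp add: kern_def)

lemma kern_antimono:
  fixes x y :: "'a::euclidean_space"
  assumes "0 < s" "x \<noteq> 0" "norm x \<le> norm y" shows "kern s y \<le> kern s x"
  using assms unfolding kern_def by (intro frac_le powr_mono2) auto

lemma kern_strict_antimono:
  fixes x y :: "'a::euclidean_space"
  assumes "0 < s" "x \<noteq> 0" "norm x < norm y" shows "kern s y < kern s x"
  using assms unfolding kern_def by (intro divide_strict_left_mono powr_less_mono2 mult_pos_pos) auto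

lemma kern_integrable_near:
  assumes "0 < s" "s < 1"
  shows "integrable lborel (\<lambda>h::'a::euclidean_space. min 1 ((norm h)\<^sup>2) * kern s h)"
proof -
  have "(norm h)\<^sup>2 = norm h powr 2" for h :: 'a
    by (cases "h = 0") (auto simp: powr_numeral)
  then show ?thesis
    using integrable_truncated_power[of "2 * s" 2, where 'a = 'a] assms by (simp add: kern_def)
qed

lemma kern_integrable_away:
  assumes s: "0 < s" "s < 1" and "0 < d"
  shows "integrable lborel (\<lambda>h::'a::euclidean_space. indicator {h. d \<le> norm h} h * kern s h)"
proof (rule Bochner_Integration.integrable_bound)
  let ?m = "min 1 (d\<^sup>2)"
  show "integrable lborel (\<lambda>h::'a. 1 / ?m * (min 1 ((norm h)\<^sup>2) * kern s h))"
    by (intro integrable_mult_right kern_integrable_near s)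
  show "(\<lambda>h::'a. indicator {h. d \<le> norm h} h * kern s h) \<in> borel_measurable lborel" by measurable
  have "indicator {h. d \<le> norm h} h * kern s h \<le> 1 / ?m * (min 1 ((norm h)\<^sup>2) * kern s h)" for h :: 'a
  proof (cases "d \<le> norm h")
    case True
    then have "?m \<le> min 1 ((norm h)\<^sup>2)" using \<open>0 < d\<close> by (intro min.mono power_mono) auto
    then have "1 \<le> 1 / ?m * min 1 ((norm h)\<^sup>2)" using \<open>0 < d\<close> by (simp add: divide_simps)
    from mult_right_mono[OF this kern_nonneg[of s h]] show ?thesis using True by simp
  qed (use \<open>0 < d\<close> in \<open>simp add: kern_nonneg\<close>)
  then show "AE h in lborel. norm (indicator {h. d \<le> norm h} h * kern s h) \<le> norm (1 / ?m * (min 1 ((norm h)\<^sup>2) * kern s (h::'a)))"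
    using \<open>0 < d\<close> by (intro AE_I2) (simp add: kern_nonneg abs_mult)
qed

section \<open>Mollified equations\<close>

definition mollify :: "real \<Rightarrow> ('a::euclidean_space \<Rightarrow> real) \<Rightarrow> 'a \<Rightarrow> real" where
  "mollify \<epsilon> w z = (\<integral>x. w (z + x) * mollifier \<epsilon> x \<partial>lborel)"

definition second_diff :: "('a::euclidean_space \<Rightarrow> real) \<Rightarrow> 'a \<Rightarrow> 'a \<Rightarrow> real" where
  "second_diff w z h = 2 * w z - w (z + h) - w (z - h)"

text \<open>The equation \<open>(-\<Delta>)\<^sup>s w = G\<close> after convolution with a mollifier, at the point \<open>z\<close>. The fractional
  Laplacian is written with symmetric second differences, so that the integral converges
  absolutely. The integrability is part of the predicate because the Bochner integral of a
  non-integrable function is \<open>0\<close>.\<close>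

definition mollified_eq ::
  "real \<Rightarrow> real \<Rightarrow> ('a::euclidean_space \<Rightarrow> real) \<Rightarrow> ('a \<Rightarrow> real) \<Rightarrow> real \<Rightarrow> 'a \<Rightarrow> bool" where
  "mollified_eq c s w G \<epsilon> z \<longleftrightarrow>
     integrable lborel (\<lambda>h. kern s h * second_diff (mollify \<epsilon> w) z h) \<and>
     c / 2 * (\<integral>h. kern s h * second_diff (mollify \<epsilon> w) z h \<partial>lborel) = mollify \<epsilon> G z"

lemma mollify_eq_shifted:
  assumes [measurable]: "w \<in> borel_measurable borel" and "\<epsilon> > 0"
  shows "(\<integral>x. w (x + k) * mollifier \<epsilon> (x - z) \<partial>lborel) = mollify \<epsilon> w (z + k)"
proof -
  note [measurable] = mollifier_measurable[OF \<open>\<epsilon> > 0\<close>]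
  have "(\<integral>x. w (x + k) * mollifier \<epsilon> (x - z) \<partial>lborel) =
      (\<integral>x. w ((z + x) + k) * mollifier \<epsilon> ((z + x) - z) \<partial>lborel)"
    by (rule integral_lborel_shift[symmetric]) measurable
  then show ?thesis by (simp add: mollify_def add_ac)
qed

text \<open>The test function is the translate \<open>\<phi>\<close> of the mollifier to \<open>z\<close>. After the substitution \<open>y = x + h\<close>
  in the energy, the inner integral over \<open>x\<close> of \<open>(u(x) - u(x+h)) (\<phi>(x) - \<phi>(x+h))\<close> expands into four
  values of the mollification of \<open>u\<close>, namely twice the one at \<open>z\<close> minus those at \<open>z + h\<close> and \<open>z - h\<close>.
  Fubini's theorem is justified by the Hoelder continuity of \<open>u\<close>: the integrand is at most a multiple of
  \<open>min 1 |h| / |h|\<^sup>N\<^sup>+\<^sup>s\<close>, supported where \<open>x\<close> or \<open>x + h\<close> lies in the compact set \<open>S\<close>.\<close>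

lemma weak_solution_mollified_eq:
  fixes u :: "'a::euclidean_space \<Rightarrow> real"
  assumes weak: "weak_solution c s U g u" and holder: "holder_continuous s u"
    and cu: "continuous_on UNIV u" and cg: "continuous_on UNIV g"
    and s: "0 < s" "s < 1" and \<epsilon>: "\<epsilon> > 0" and sub: "cball z \<epsilon> \<subseteq> U"
  shows "mollified_eq c s u g \<epsilon> z"
proof -
  note \<epsilon>m = mollifier_measurable[OF \<epsilon>, measurable]
  have [measurable]: "u \<in> borel_measurable borel" "g \<in> borel_measurable borel"
    using cu cg by (simp_all add: borel_measurable_continuous_onI)
  define \<phi> where "\<phi> x = mollifier \<epsilon> (x - z)" for x
  have [measurable]: "\<phi> \<in> borel_measurable borel" unfolding \<phi>_def by measurable
  define S where "S = cball z \<epsilon>"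
  have [measurable]: "S \<in> sets borel" by (simp add: S_def)
  have \<phi>S: "\<phi> x = 0" if "x \<notin> S" for x
    using that mollifier_eq_0[OF \<epsilon>, of "x - z"] by (auto simp: S_def \<phi>_def dist_norm norm_minus_commute)
  obtain L where L: "\<bar>u x - u y\<bar> \<le> L * norm (x - y) powr s" for x y
    using holder by (auto simp: holder_continuous_def)
  obtain C where C: "0 \<le> C" "\<bar>mollifier \<epsilon> x - mollifier \<epsilon> y\<bar> \<le> C * min 1 (norm (x - y))" for x y :: 'a
    using mollifier_modulus[OF \<epsilon>] by metis
  define \<Psi> where "\<Psi> h = min 1 (norm h powr 1) / norm h powr (real DIM('a) + s)" for h :: 'a
  have \<Psi>: "integrable lborel \<Psi>" unfolding \<Psi>_def by (rule integrable_truncated_power) (use s in auto)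
  have [measurable]: "\<Psi> \<in> borel_measurable borel" using borel_measurable_integrable[OF \<Psi>] by simp
  have [measurable]: "kern s \<in> borel_measurable (borel :: 'a measure)" unfolding kern_def by measurable
  let ?F = "energy_integrand s u \<phi>"
  let ?F' = "\<lambda>x h. kern s h * ((u x - u (x + h)) * (\<phi> x - \<phi> (x + h)))"
  have F': "?F (x, x + h) = ?F' x h" for x h
    by (simp add: energy_integrand_def kern_def)
  have "0 \<le> L"
  proof -
    obtain b :: 'a where "norm b = 1" using vector_choose_size[of 1] by auto
    then show ?thesis using L[of b 0] by simp
  qed
  have bound: "\<bar>?F' x h\<bar> \<le> L * C * (\<Psi> h * (indicator S x + indicator S (x + h)))" for x h
  proof (cases "h = 0")
    case False
    have 1: "\<bar>u x - u (x + h)\<bar> \<le> L * norm h powr s" using L[of x "x + h"] by simp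
    have 2: "\<bar>\<phi> x - \<phi> (x + h)\<bar> \<le> C * min 1 (norm h) * (indicator S x + indicator S (x + h))"
    proof (cases "x \<in> S \<or> x + h \<in> S")
      case True
      have "\<bar>\<phi> x - \<phi> (x + h)\<bar> \<le> C * min 1 (norm h) * 1"
        using C(2)[of "x - z" "x + h - z"] by (simp add: \<phi>_def)
      also have "\<dots> \<le> C * min 1 (norm h) * (indicator S x + indicator S (x + h))"
        using True C(1) by (intro mult_left_mono) (auto simp: indicator_def)
      finally show ?thesis .
    qed (simp add: \<phi>S)
    have "\<bar>?F' x h\<bar> \<le> kern s h * ((L * norm h powr s) * (C * min 1 (norm h) * (indicator S x + indicator S (x + h))))"
      unfolding abs_mult by (intro mult_mono mult_left_mono 1 2) (auto simp: kern_def \<open>0 \<le> L\<close>)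
    also have "kern s h * norm h powr s = 1 / norm h powr (real DIM('a) + s)"
      using False by (simp add: kern_def powr_add divide_simps) (simp add: powr_add[symmetric])
    then have "(kern s h * norm h powr s) * (L * (C * min 1 (norm h) * (indicator S x + indicator S (x + h)))) =
        L * C * (\<Psi> h * (indicator S x + indicator S (x + h)))"
      by (simp add: \<Psi>_def mult_ac) 
    then have "kern s h * ((L * norm h powr s) * (C * min 1 (norm h) * (indicator S x + indicator S (x + h)))) =
        L * C * (\<Psi> h * (indicator S x + indicator S (x + h)))"
      by (simp only: mult_ac)
    finally show ?thesis .
  qed (simp add: \<Psi>_def)
  \<comment> \<open>For fixed \<open>h\<close> the integral of the bound over \<open>x\<close> is \<open>\<Psi> h\<close> times twice the volume of \<open>S\<close>.\<close>
  have fin: "(\<integral>\<^sup>+x. \<integral>\<^sup>+h. ennreal \<bar>?F' x h\<bar> \<partial>lborel \<partial>lborel) < \<infinity>"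
  proof -
    have \<Psi>0: "0 \<le> \<Psi> h" for h by (simp add: \<Psi>_def)
    have "(\<integral>\<^sup>+x. \<integral>\<^sup>+h. ennreal \<bar>?F' x h\<bar> \<partial>lborel \<partial>lborel) \<le>
      (\<integral>\<^sup>+x. \<integral>\<^sup>+h. ennreal (L * C * \<Psi> h) * (indicator S x + indicator S (x + h)) \<partial>lborel \<partial>lborel)"
    proof (intro nn_integral_mono)
      fix x h
      have "ennreal \<bar>?F' x h\<bar> \<le> ennreal (L * C * \<Psi> h * (indicator S x + indicator S (x + h)))"
        using bound[of h x] by (intro ennreal_leI) (simp add: mult.assoc)
      also have "\<dots> = ennreal (L * C * \<Psi> h) * (indicator S x + indicator S (x + h))"
        using \<open>0 \<le> L\<close> C(1) \<Psi>0[of h] by (simp add: ennreal_mult ennreal_plus ennreal_indicator) 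
      finally show "ennreal \<bar>?F' x h\<bar> \<le> ennreal (L * C * \<Psi> h) * (indicator S x + indicator S (x + h))" .
    qed
    also have "\<dots> = (\<integral>\<^sup>+h. \<integral>\<^sup>+x. ennreal (L * C * \<Psi> h) * (indicator S x + indicator S (x + h)) \<partial>lborel \<partial>lborel)"
      by (rule lborel_pair.Fubini') measurable
    also have "\<dots> = (\<integral>\<^sup>+h. ennreal (L * C * \<Psi> h) * (emeasure lborel S + emeasure lborel S) \<partial>lborel)"
    proof (intro nn_integral_cong)
      fix h :: 'a
      have "(\<integral>\<^sup>+x. indicator S (x + h) \<partial>lborel) = emeasure lborel S"
        using nn_integral_lborel_shift[of "indicator S" h] by (simp add: add.commute)
      then show "(\<integral>\<^sup>+x. ennreal (L * C * \<Psi> h) * (indicator S x + indicator S (x + h)) \<partial>lborel) =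
          ennreal (L * C * \<Psi> h) * (emeasure lborel S + emeasure lborel S)"
        by (simp add: nn_integral_cmult nn_integral_add)
    qed
    also have "\<dots> = (\<integral>\<^sup>+h. ennreal (L * C * \<Psi> h) \<partial>lborel) * (emeasure lborel S + emeasure lborel S)"
      by (rule nn_integral_multc) measurable
    also have "\<dots> < \<infinity>"
    proof -
      have "(\<integral>\<^sup>+h. ennreal (L * C * \<Psi> h) \<partial>lborel) < \<infinity>"
        using \<open>0 \<le> L\<close> C(1) \<Psi>0 \<Psi> by (subst nn_integral_eq_integral) auto
      moreover have "emeasure lborel S < \<infinity>" unfolding S_def using emeasure_bounded_finite[of "cball z \<epsilon>"] by (simp add: less_top)
      ultimately show ?thesis by (simp add: ennreal_mult_less_top)
    qed
    finally show ?thesis .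
  qed
  have F_meas: "?F \<in> borel_measurable (lborel \<Otimes>\<^sub>M lborel)"
    unfolding energy_integrand_def by measurable
  have intF: "integrable (lborel \<Otimes>\<^sub>M lborel) ?F"
  proof (rule integrableI_bounded[OF F_meas])
    have "(\<integral>\<^sup>+p. ennreal (norm (?F p)) \<partial>(lborel \<Otimes>\<^sub>M lborel)) = (\<integral>\<^sup>+x. \<integral>\<^sup>+y. ennreal \<bar>?F (x, y)\<bar> \<partial>lborel \<partial>lborel)"
      using F_meas by (subst lborel.nn_integral_fst[symmetric]) auto
    also have "\<dots> = (\<integral>\<^sup>+x. \<integral>\<^sup>+h. ennreal \<bar>?F (x, x + h)\<bar> \<partial>lborel \<partial>lborel)"
      by (intro nn_integral_cong nn_integral_lborel_shift[symmetric]) (simp add: energy_integrand_def)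
    finally show "(\<integral>\<^sup>+p. ennreal (norm (?F p)) \<partial>(lborel \<Otimes>\<^sub>M lborel)) < \<infinity>"
      using fin by (simp add: F')
  qed
  have intF': "integrable (lborel \<Otimes>\<^sub>M lborel) (\<lambda>(x, h). ?F' x h)"
  proof (rule integrableI_bounded)
    show m: "(\<lambda>(x, h). ?F' x h) \<in> borel_measurable (lborel \<Otimes>\<^sub>M lborel)" by measurable
    show "(\<integral>\<^sup>+p. ennreal (norm (case p of (x, h) \<Rightarrow> ?F' x h)) \<partial>(lborel \<Otimes>\<^sub>M lborel)) < \<infinity>"
      using fin m by (subst lborel.nn_integral_fst[symmetric]) auto
  qed
  have inner: "(\<integral>x. ?F' x h \<partial>lborel) = kern s h * second_diff (mollify \<epsilon> u) z h" for h
  proof -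
    have c': "continuous_on UNIV (\<lambda>x. u (x + k))" for k
      using cu by (auto intro!: continuous_intros continuous_on_compose2[OF cu])
    have i: "integrable lborel (\<lambda>x. u (x + k) * \<phi> x)" for k
      unfolding \<phi>_def by (rule integrable_mult_mollifier[OF \<epsilon> c'])
    have e: "(\<integral>x. u (x + k) * \<phi> x \<partial>lborel) = mollify \<epsilon> u (z + k)" for k
      unfolding \<phi>_def by (rule mollify_eq_shifted[OF _ \<epsilon>]) measurable
    have i': "integrable lborel (\<lambda>x. u (x + k) * \<phi> (x + h))"
      and e': "(\<integral>x. u (x + k) * \<phi> (x + h) \<partial>lborel) = mollify \<epsilon> u (z + k - h)" for k
    proof -
      have m: "(\<lambda>x. u (x + (k - h)) * \<phi> x) \<in> borel_measurable borel" by measurable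
      show "integrable lborel (\<lambda>x. u (x + k) * \<phi> (x + h))"
        using integrable_lborel_shift[OF m, of h] i[of "k - h"] by (simp add: algebra_simps)
      show "(\<integral>x. u (x + k) * \<phi> (x + h) \<partial>lborel) = mollify \<epsilon> u (z + k - h)"
        using integral_lborel_shift[OF m, of h] e[of "k - h"] by (simp add: algebra_simps)
    qed
    have "(\<integral>x. ?F' x h \<partial>lborel) = kern s h * (\<integral>x. (u x - u (x + h)) * (\<phi> x - \<phi> (x + h)) \<partial>lborel)"
      by simp
    also have "(\<integral>x. (u x - u (x + h)) * (\<phi> x - \<phi> (x + h)) \<partial>lborel) =
       (\<integral>x. (u (x + 0) * \<phi> x - u (x + h) * \<phi> x) - (u (x + 0) * \<phi> (x + h) - u (x + h) * \<phi> (x + h)) \<partial>lborel)"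
      by (intro Bochner_Integration.integral_cong) (auto simp: algebra_simps)
    also have "\<dots> = second_diff (mollify \<epsilon> u) z h"
      using e[of 0] e[of h] e'[of 0] e'[of h] i[of 0] i[of h] i'[of 0] i'[of h]
      by (simp add: second_diff_def)
    finally show ?thesis .
  qed
  have test: "\<phi> \<in> test_functions U" unfolding \<phi>_def by (rule mollifier_test_function[OF \<epsilon> sub])
  have "integral\<^sup>L (lborel \<Otimes>\<^sub>M lborel) ?F = (\<integral>x. \<integral>y. ?F (x, y) \<partial>lborel \<partial>lborel)"
    using lborel_pair.integral_fst'[OF intF] by simp
  also have "\<dots> = (\<integral>x. \<integral>h. ?F (x, x + h) \<partial>lborel \<partial>lborel)"
    by (intro Bochner_Integration.integral_cong integral_lborel_shift[symmetric] refl) (simp add: energy_integrand_def)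
  also have "\<dots> = (\<integral>h. \<integral>x. ?F' x h \<partial>lborel \<partial>lborel)"
    unfolding F' by (rule lborel_pair.Fubini_integral[OF intF', symmetric])
  also have "\<dots> = (\<integral>h. kern s h * second_diff (mollify \<epsilon> u) z h \<partial>lborel)"
    by (simp only: inner)
  finally have E: "energy c s u \<phi> = c / 2 * (\<integral>h. kern s h * second_diff (mollify \<epsilon> u) z h \<partial>lborel)"
    by (simp add: energy_def)
  have "energy c s u \<phi> = (LINT x:U|lborel. g x * \<phi> x)"
    using weak test by (auto simp: weak_solution_def)
  also have "\<dots> = (\<integral>x. g (x + 0) * \<phi> x \<partial>lborel)"
    unfolding set_lebesgue_integral_def
  proof (intro Bochner_Integration.integral_cong refl)
    show "indicator U x *\<^sub>R (g x * \<phi> x) = g (x + 0) * \<phi> x" for x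
      using \<phi>S[of x] subsetD[OF sub, of x] by (cases "x \<in> U") (auto simp: S_def)
  qed
  also have "\<dots> = mollify \<epsilon> g z"
    unfolding \<phi>_def by (subst mollify_eq_shifted[OF _ \<epsilon>]) auto
  finally have "c / 2 * (\<integral>h. kern s h * second_diff (mollify \<epsilon> u) z h \<partial>lborel) = mollify \<epsilon> g z"
    using E by simp
  moreover have "integrable lborel (\<lambda>h. kern s h * second_diff (mollify \<epsilon> u) z h)"
    using lborel_pair.integrable_snd[OF intF'] by (simp only: inner)
  ultimately show ?thesis by (simp add: mollified_eq_def)
qed

lemma integrable_translate_mollifier:
  assumes "\<epsilon> > 0" "continuous_on UNIV w"
  shows "integrable lborel (\<lambda>x. w (z + x) * mollifier \<epsilon> x)"
proof -
  have "continuous_on UNIV (\<lambda>x. w (z + x))"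
    by (auto intro!: continuous_intros continuous_on_compose2[OF assms(2)])
  from integrable_mult_mollifier[OF assms(1) this, of 0] show ?thesis by simp
qed

lemma mollify_le:
  assumes \<epsilon>: "\<epsilon> > 0" and w: "continuous_on UNIV w" and le: "\<And>x. norm x < \<epsilon> \<Longrightarrow> w (z + x) \<le> b"
  shows "mollify \<epsilon> w z \<le> b"
proof -
  have "mollify \<epsilon> w z \<le> (\<integral>x. b * mollifier \<epsilon> (x::'a) \<partial>lborel)"
    unfolding mollify_def
  proof (rule integral_mono[OF integrable_translate_mollifier[OF \<epsilon> w]])
    show "integrable lborel (\<lambda>x. b * mollifier \<epsilon> (x::'a))"
      using integrable_translate_mollifier[OF \<epsilon>, of "\<lambda>x. b"] by simp
    show "w (z + x) * mollifier \<epsilon> x \<le> b * mollifier \<epsilon> x" for x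
      using le[of x] mollifier_nonneg[OF \<epsilon>, of x] mollifier_eq_0[OF \<epsilon>, of x]
      by (cases "norm x < \<epsilon>") (auto intro: mult_right_mono)
  qed
  then show ?thesis by (simp add: integral_mollifier[OF \<epsilon>])
qed

lemma mollify_diff:
  assumes "\<epsilon> > 0" "continuous_on UNIV v" "continuous_on UNIV w"
  shows "mollify \<epsilon> (\<lambda>x. v x - w x) z = mollify \<epsilon> v z - mollify \<epsilon> w z"
  unfolding mollify_def left_diff_distrib
  by (intro Bochner_Integration.integral_diff integrable_translate_mollifier assms)

lemma mollify_minus: "mollify \<epsilon> (\<lambda>x. - w x) z = - mollify \<epsilon> w z"
  by (simp add: mollify_def)

lemma mollify_close:
  assumes \<epsilon>: "\<epsilon> > 0" and w: "continuous_on UNIV w" and le: "\<And>x. norm x < \<epsilon> \<Longrightarrow> \<bar>w (z + x) - b\<bar> \<le> d"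
  shows "\<bar>mollify \<epsilon> w z - b\<bar> \<le> d"
proof -
  have "mollify \<epsilon> w z \<le> b + d" by (rule mollify_le[OF \<epsilon> w]) (use le in force)
  moreover have "mollify \<epsilon> (\<lambda>x. - w x) z \<le> - b + d"
    by (rule mollify_le[OF \<epsilon>]) (use w le in \<open>force intro: continuous_intros\<close>)+
  ultimately show ?thesis by (simp add: mollify_minus)
qed

lemma continuous_mollify:
  assumes \<epsilon>: "\<epsilon> > 0" and uc: "uniformly_continuous_on UNIV (w :: 'a::euclidean_space \<Rightarrow> real)"
  shows "continuous_on UNIV (mollify \<epsilon> w)"
  unfolding continuous_on_iff
proof (intro ballI allI impI)
  fix z :: 'a and d :: real assume "0 < d"
  note w = uniformly_continuous_imp_continuous[OF uc]
  obtain \<delta> where \<delta>: "\<delta> > 0" "\<And>x y. dist y x < \<delta> \<Longrightarrow> dist (w y) (w x) < d / 2"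
    using uc \<open>0 < d\<close> by (force simp: uniformly_continuous_on_def dest: spec[of _ "d / 2"])
  show "\<exists>\<delta>>0. \<forall>z'\<in>UNIV. dist z' z < \<delta> \<longrightarrow> dist (mollify \<epsilon> w z') (mollify \<epsilon> w z) < d"
  proof (intro exI[of _ \<delta>] conjI ballI impI \<delta>(1))
    fix z' assume z': "dist z' z < \<delta>"
    have c: "continuous_on UNIV (\<lambda>x. w (x + (z' - z)))"
      by (auto intro!: continuous_intros continuous_on_compose2[OF w])
    have "mollify \<epsilon> w z' - mollify \<epsilon> w z = mollify \<epsilon> (\<lambda>x. w (x + (z' - z)) - w x) z"
      by (simp add: mollify_diff[OF \<epsilon> c w]) (simp add: mollify_def add_ac)
    moreover have "\<bar>mollify \<epsilon> (\<lambda>x. w (x + (z' - z)) - w x) z - 0\<bar> \<le> d / 2"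
    proof (rule mollify_close[OF \<epsilon>])
      show "continuous_on UNIV (\<lambda>x. w (x + (z' - z)) - w x)" by (intro continuous_intros c w)
      show "\<bar>w (z + x + (z' - z)) - w (z + x) - 0\<bar> \<le> d / 2" for x
        using \<delta>(2)[of "z + x + (z' - z)" "z + x"] z' by (simp add: dist_norm)
    qed
    ultimately show "dist (mollify \<epsilon> w z') (mollify \<epsilon> w z) < d" using \<open>0 < d\<close> by (simp add: dist_real_def)
  qed
qed

lemma mollified_eq_minus: "mollified_eq c s u g \<epsilon> z \<Longrightarrow> mollified_eq c s (\<lambda>x. - u x) (\<lambda>x. - g x) \<epsilon> z"
proof -
  have "kern s h * second_diff (mollify \<epsilon> (\<lambda>x. - u x)) z h = - (kern s h * second_diff (mollify \<epsilon> u) z h)" for h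
    by (simp add: second_diff_def mollify_minus algebra_simps)
  then show "mollified_eq c s u g \<epsilon> z \<Longrightarrow> ?thesis" by (simp add: mollified_eq_def mollify_minus)
qed

section \<open>Pointwise inequality at a local minimum\<close>

text \<open>The mollifications \<open>W\<close> of \<open>w\<close> converge uniformly but need not have a minimum at \<open>x\<close>. Adding the
  paraboloid \<open>|y - x|\<^sup>2\<close> makes the minimum of \<open>w\<close> at \<open>x\<close> strict, so that the perturbed mollifications
  have minimum points \<open>z\<close> converging to \<open>x\<close>. There the second difference of \<open>W\<close> is at most
  \<open>2|h|\<^sup>2\<close> for small \<open>h\<close>, the contribution of the paraboloid. Thus the integrands are bounded above by
  one integrable function, and Fatou's lemma passes to the limit in the mollified equations. The
  upper bound on the second differences is one-sided; integrability of the limit is part of the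
  conclusion.\<close>

lemma local_min_inequality:
  fixes w :: "'a::euclidean_space \<Rightarrow> real"
  assumes "0 < c" and s: "0 < s" "s < 1"
    and uc: "uniformly_continuous_on UNIV w" and bd: "\<And>y. \<bar>w y\<bar> \<le> B"
    and G: "continuous_on UNIV G"
    and r: "0 < r" "\<And>y. dist x y < r \<Longrightarrow> w x \<le> w y"
    and r0: "0 < r0" "\<And>\<epsilon> z. 0 < \<epsilon> \<Longrightarrow> \<epsilon> < r0 \<Longrightarrow> dist x z < r0 \<Longrightarrow> mollified_eq c s w G \<epsilon> z"
  shows "integrable lborel (\<lambda>h. kern s h * second_diff w x h)" (is ?I)
    and "G x \<le> c / 2 * (\<integral>h. kern s h * second_diff w x h \<partial>lborel)" (is ?J)
proof -
  note w = uniformly_continuous_imp_continuous[OF uc]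
  have [measurable]: "w \<in> borel_measurable borel" using w by (simp add: borel_measurable_continuous_onI)
  have "0 \<le> B" using bd[of x] by linarith
  \<comment> \<open>The minimum points will lie within \<open>\<rho>\<close> of \<open>x\<close>, and increments up to \<open>\<rho>\<close> then stay in the
    ball of radius \<open>2\<rho>\<close> over which the minimum is taken.\<close>
  define \<rho> where "\<rho> = min 1 (min r r0) / 4"
  have \<rho>: "0 < \<rho>" "2 * \<rho> < r" "2 * \<rho> < r0" "\<rho> \<le> 1" using r(1) r0(1) by (auto simp: \<rho>_def min_def)
  define \<delta> where "\<delta> n = \<rho>\<^sup>2 / (8 * (real n + 1))" for n
  have \<delta>: "0 < \<delta> n" "\<delta> n \<le> \<rho>\<^sup>2 / 8" for n using \<rho>(1) by (auto simp: \<delta>_def divide_simps)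
  have \<delta>_lim: "\<delta> \<longlonglongrightarrow> 0" unfolding \<delta>_def by real_asymp
  have "\<exists>\<epsilon>. 0 < \<epsilon> \<and> \<epsilon> < r0 \<and> \<epsilon> \<le> \<delta> n \<and> (\<forall>z. \<bar>mollify \<epsilon> w z - w z\<bar> \<le> \<delta> n)" for n
  proof -
    obtain d where d: "d > 0" "\<And>x y. dist y x < d \<Longrightarrow> dist (w y) (w x) < \<delta> n"
      using uc \<delta>(1)[of n] by (force simp: uniformly_continuous_on_def dest: spec[of _ "\<delta> n"])
    define \<epsilon> where "\<epsilon> = min d (min (\<delta> n) (r0 / 2))"
    have \<epsilon>: "0 < \<epsilon>" "\<epsilon> < r0" "\<epsilon> \<le> \<delta> n" "\<epsilon> \<le> d" using d(1) \<delta>(1)[of n] r0(1) by (auto simp: \<epsilon>_def)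
    moreover have "\<bar>mollify \<epsilon> w z - w z\<bar> \<le> \<delta> n" for z
    proof (rule mollify_close[OF \<epsilon>(1) w])
      show "\<bar>w (z + x) - w z\<bar> \<le> \<delta> n" if "norm x < \<epsilon>" for x
        using d(2)[of "z + x" z] that \<epsilon>(4) by (simp add: dist_norm)
    qed
    ultimately show ?thesis by blast
  qed
  then obtain \<epsilon> where \<epsilon>: "0 < \<epsilon> n" "\<epsilon> n < r0" "\<epsilon> n \<le> \<delta> n" and close: "\<bar>mollify (\<epsilon> n) w z - w z\<bar> \<le> \<delta> n" for n z
    by metis
  define W where "W n = mollify (\<epsilon> n) w" for n
  have cW: "continuous_on UNIV (W n)" for n unfolding W_def by (rule continuous_mollify[OF \<epsilon>(1) uc])
  have [measurable]: "W n \<in> borel_measurable borel" for n using cW by (simp add: borel_measurable_continuous_onI)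
  have "\<exists>z\<in>cball x (2 * \<rho>). \<forall>y\<in>cball x (2 * \<rho>). W n z + (norm (z - x))\<^sup>2 \<le> W n y + (norm (y - x))\<^sup>2" for n
    using \<rho>(1) by (intro continuous_attains_inf continuous_intros continuous_on_subset[OF cW]) auto
  then obtain z where z: "dist x (z n) \<le> 2 * \<rho>"
    and zmin: "dist x y \<le> 2 * \<rho> \<Longrightarrow> W n (z n) + (norm (z n - x))\<^sup>2 \<le> W n y + (norm (y - x))\<^sup>2" for n y
    by (simp only: mem_cball Ball_def Bex_def) metis
  \<comment> \<open>Compare the minimum with the value at \<open>x\<close>: the errors of mollification enter twice.\<close>
  have z_sq: "(norm (z n - x))\<^sup>2 \<le> 2 * \<delta> n" for n
    using zmin[of x n] \<rho> r(2)[of "z n"] z[of n] close[of n x] close[of n "z n"] by (simp add: W_def abs_le_iff)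
  have z_near: "norm (z n - x) \<le> \<rho>" for n
  proof (rule power2_le_imp_le)
    show "(norm (z n - x))\<^sup>2 \<le> \<rho>\<^sup>2" using z_sq[of n] \<delta>(2)[of n] zero_le_power2[of \<rho>] by linarith
  qed (use \<rho> in simp)
  have "(\<lambda>n. (norm (z n - x))\<^sup>2) \<longlonglongrightarrow> 0"
    by (rule tendsto_sandwich[of "\<lambda>_. 0" _ _ "\<lambda>n. 2 * \<delta> n"])
      (use z_sq \<delta>_lim in \<open>auto intro: tendsto_mult_right_zero\<close>)
  then have "(\<lambda>n. sqrt ((norm (z n - x))\<^sup>2)) \<longlonglongrightarrow> sqrt 0" by (rule tendsto_real_sqrt)
  then have z_lim: "z \<longlonglongrightarrow> x" by (simp add: LIM_zero_iff tendsto_norm_zero_iff)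
  have \<epsilon>_lim: "\<epsilon> \<longlonglongrightarrow> 0"
    by (rule tendsto_sandwich[of "\<lambda>_. 0" _ _ \<delta>]) (use \<epsilon> \<delta>_lim in \<open>auto simp: less_imp_le\<close>)
  have W_lim: "(\<lambda>n. W n (z n + h)) \<longlonglongrightarrow> w (x + h)" for h
  proof -
    have "(\<lambda>n. w (z n + h)) \<longlonglongrightarrow> w (x + h)"
      by (rule continuous_on_tendsto_compose[OF w]) (auto intro!: tendsto_intros z_lim)
    moreover have "(\<lambda>n. W n (z n + h) - w (z n + h)) \<longlonglongrightarrow> 0"
      by (rule Lim_null_comparison[OF _ \<delta>_lim]) (simp add: close W_def)
    ultimately show ?thesis using tendsto_add by fastforce
  qed
  have G_lim: "(\<lambda>n. mollify (\<epsilon> n) G (z n)) \<longlonglongrightarrow> G x"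
  proof (rule LIMSEQ_I)
    fix d :: real assume "0 < d"
    then obtain \<eta> where \<eta>: "\<eta> > 0" "\<And>y. dist y x < \<eta> \<Longrightarrow> dist (G y) (G x) < d / 2"
      using G unfolding continuous_on_iff by (metis UNIV_I half_gt_zero)
    have "eventually (\<lambda>n. norm (z n - x) < \<eta> / 2 \<and> \<epsilon> n < \<eta> / 2) sequentially"
      using order_tendstoD(2)[OF \<epsilon>_lim, of "\<eta> / 2"] tendstoD[OF z_lim, of "\<eta> / 2"] \<eta>(1)
      by (simp add: eventually_conj_iff dist_norm)
    then obtain N where N: "\<And>n. n \<ge> N \<Longrightarrow> norm (z n - x) < \<eta> / 2 \<and> \<epsilon> n < \<eta> / 2"
      by (auto simp: eventually_sequentially)
    have "norm (mollify (\<epsilon> n) G (z n) - G x) < d" if "n \<ge> N" for n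
    proof -
      have "\<bar>mollify (\<epsilon> n) G (z n) - G x\<bar> \<le> d / 2"
      proof (rule mollify_close[OF \<epsilon>(1) G])
        fix y :: 'a assume y: "norm y < \<epsilon> n"
        have "norm (z n + y - x) \<le> norm (z n - x) + norm y"
          using norm_triangle_ineq[of "z n - x" y] by (simp only: diff_add_eq)
        then have "dist (z n + y) x < \<eta>" using N[OF that] y by (simp add: dist_norm)
        from \<eta>(2)[OF this] show "\<bar>G (z n + y) - G x\<bar> \<le> d / 2" by (simp add: dist_real_def)
      qed
      then show ?thesis using \<open>0 < d\<close> by simp
    qed
    then show "\<exists>N. \<forall>n\<ge>N. norm (mollify (\<epsilon> n) G (z n) - G x) < d" by blast
  qed
  \<comment> \<open>The constant covers \<open>2|h|\<^sup>2\<close> for \<open>|h| \<le> \<rho>\<close> and the trivial bound \<open>4B\<close> for larger \<open>h\<close>.\<close>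
  define C where "C = 2 + 4 * B / \<rho>\<^sup>2"
  define \<Phi> where "\<Phi> h = C * (min 1 ((norm h)\<^sup>2) * kern s h)" for h :: 'a
  have \<Phi>: "integrable lborel \<Phi>" unfolding \<Phi>_def by (intro integrable_mult_right kern_integrable_near s)
  have [measurable]: "\<Phi> \<in> borel_measurable borel" unfolding \<Phi>_def by measurable
  have "0 \<le> 4 * B / \<rho>\<^sup>2" using \<open>0 \<le> B\<close> by simp
  then have C: "2 \<le> C" unfolding C_def by simp
  have sd: "second_diff (W n) (z n) h \<le> C * min 1 ((norm h)\<^sup>2)" for n h
  proof (cases "norm h \<le> \<rho>")
    case True
    have "norm (z n + h - x) \<le> norm (z n - x) + norm h"
      using norm_triangle_ineq[of "z n - x" h] by (simp only: diff_add_eq)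
    moreover have "norm (z n - h - x) \<le> norm (z n - x) + norm h" 
      using norm_triangle_ineq4[of "z n - x" h] by (simp only: diff_diff_eq add.commute)
    ultimately have "dist x (z n + h) \<le> 2 * \<rho>" "dist x (z n - h) \<le> 2 * \<rho>"
      using True z_near[of n] by (simp_all add: dist_norm norm_minus_commute)
    from this[THEN zmin[where n = n]]
    have "second_diff (W n) (z n) h \<le> (norm (z n + h - x))\<^sup>2 + (norm (z n - h - x))\<^sup>2 - 2 * (norm (z n - x))\<^sup>2"
      by (simp add: second_diff_def)
    also have "\<dots> = 2 * (norm h)\<^sup>2"
      by (simp add: power2_norm_eq_inner algebra_simps inner_commute)
    also have "\<dots> \<le> C * min 1 ((norm h)\<^sup>2)"
    proof -
      have "(norm h)\<^sup>2 \<le> 1" using True \<rho>(4) by (simp add: power_le_one)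
      then show ?thesis using C by (simp add: min_def mult_right_mono)
    qed
    finally show ?thesis .
  next
    case False
    have Wb: "\<bar>W n y\<bar> \<le> B" for y unfolding W_def
      using mollify_close[OF \<epsilon>(1) w, of n y 0 B] bd by simp
    have "second_diff (W n) (z n) h \<le> 4 * B"
      using Wb[of "z n"] Wb[of "z n + h"] Wb[of "z n - h"] by (simp add: second_diff_def)
    also have "\<dots> \<le> C * \<rho>\<^sup>2" using \<rho>(1) by (simp add: C_def field_simps)
    also have "\<dots> \<le> C * min 1 ((norm h)\<^sup>2)"
      using False \<rho> C by (intro mult_left_mono) (auto simp: power_le_one intro: power_mono)
    finally show ?thesis .
  qed
  define F where "F n h = kern s h * second_diff (W n) (z n) h" for n h
  define F0 where "F0 h = kern s h * second_diff w x h" for h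
  have [measurable]: "F n \<in> borel_measurable borel" for n unfolding F_def second_diff_def by measurable
  have [measurable]: "F0 \<in> borel_measurable borel" unfolding F0_def second_diff_def by measurable
  have F_le: "F n h \<le> \<Phi> h" for n h
    using mult_left_mono[OF sd kern_nonneg] by (simp add: F_def \<Phi>_def mult_ac)
  have F_lim: "(\<lambda>n. F n h) \<longlonglongrightarrow> F0 h" for h
    using W_lim[of 0] W_lim[of h] W_lim[of "- h"]
    by (auto simp: F_def F0_def second_diff_def intro!: tendsto_intros)
  have F0_le: "F0 h \<le> \<Phi> h" for h by (rule LIMSEQ_le_const2[OF F_lim]) (use F_le in auto)
  have eq: "mollified_eq c s w G (\<epsilon> n) (z n)" for n
    using r0(2)[OF \<epsilon>(1,2)] z[of n] \<rho>(3) by auto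
  then have F_int: "integrable lborel (F n)" and F_val: "(\<integral>h. F n h \<partial>lborel) = 2 / c * mollify (\<epsilon> n) G (z n)" for n
    using \<open>0 < c\<close> by (auto simp: mollified_eq_def F_def[abs_def] W_def field_simps)
  define A where "A n = (\<integral>h. \<Phi> h \<partial>lborel) - 2 / c * mollify (\<epsilon> n) G (z n)" for n
  define A0 where "A0 = (\<integral>h. \<Phi> h \<partial>lborel) - 2 / c * G x"
  have A_val: "(\<integral>\<^sup>+h. ennreal (\<Phi> h - F n h) \<partial>lborel) = ennreal (A n)" for n
    using F_le by (subst nn_integral_eq_integral) (auto simp: A_def \<Phi> F_int F_val)
  have A_nonneg: "0 \<le> A n" for n
  proof -
    have "0 \<le> (\<integral>h. \<Phi> h - F n h \<partial>lborel)" using F_le by (intro Bochner_Integration.integral_nonneg) simp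
    then show ?thesis by (simp add: A_def \<Phi> F_int F_val)
  qed
  have A_lim: "A \<longlonglongrightarrow> A0" unfolding A_def A0_def by (intro tendsto_intros G_lim)
  have A0: "0 \<le> A0" by (rule LIMSEQ_le_const[OF A_lim]) (use A_nonneg in auto)
  \<comment> \<open>Fatou's lemma for the nonnegative functions \<open>\<Phi> - F n\<close>, whose integrals \<open>A n\<close> are known from the
    mollified equations.\<close>
  have "(\<integral>\<^sup>+h. ennreal (\<Phi> h - F0 h) \<partial>lborel) = (\<integral>\<^sup>+h. liminf (\<lambda>n. ennreal (\<Phi> h - F n h)) \<partial>lborel)"
  proof (intro nn_integral_cong)
    fix h
    have "(\<lambda>n. ennreal (\<Phi> h - F n h)) \<longlonglongrightarrow> ennreal (\<Phi> h - F0 h)"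
      by (intro tendsto_ennrealI tendsto_intros F_lim)
    then show "ennreal (\<Phi> h - F0 h) = liminf (\<lambda>n. ennreal (\<Phi> h - F n h))"
      by (rule lim_imp_Liminf[symmetric, rotated]) simp
  qed
  also have "\<dots> \<le> liminf (\<lambda>n. \<integral>\<^sup>+h. ennreal (\<Phi> h - F n h) \<partial>lborel)"
    by (rule nn_integral_liminf) measurable
  also have "\<dots> = ennreal A0"
    unfolding A_val by (intro lim_imp_Liminf tendsto_ennrealI A_lim) simp
  finally have le: "(\<integral>\<^sup>+h. ennreal (\<Phi> h - F0 h) \<partial>lborel) \<le> ennreal A0" .
  have int: "integrable lborel (\<lambda>h. \<Phi> h - F0 h)"
    using F0_le le by (intro integrableI_nonneg) (auto simp: le_less_trans)
  have "integrable lborel (\<lambda>h. \<Phi> h - (\<Phi> h - F0 h))" by (rule Bochner_Integration.integrable_diff[OF \<Phi> int])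
  then have F0_int: "integrable lborel F0" by simp
  then show ?I by (simp add: F0_def[abs_def])
  have "ennreal (\<integral>h. \<Phi> h - F0 h \<partial>lborel) \<le> ennreal A0"
    using le F0_le by (subst nn_integral_eq_integral[symmetric, OF int]) auto
  then have "(\<integral>h. \<Phi> h \<partial>lborel) - (\<integral>h. F0 h \<partial>lborel) \<le> A0"
    using A0 by (simp add: \<Phi> F0_int)
  then have "2 / c * G x \<le> (\<integral>h. F0 h \<partial>lborel)" by (simp add: A0_def)
  then show ?J using \<open>0 < c\<close> by (simp add: F0_def field_simps)
qed

section \<open>Reflections in hyperplanes\<close>

definition reflect :: "'a::euclidean_space \<Rightarrow> real \<Rightarrow> 'a \<Rightarrow> 'a" where
  "reflect e \<mu> x = x - (2 * (x \<bullet> e - \<mu>)) *\<^sub>R e"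

context
  fixes e :: "'a::euclidean_space" assumes e: "norm e = 1"
begin

lemma ee: "e \<bullet> e = 1" using e by (simp add: norm_eq_1)

lemma reflect_inner: "reflect e \<mu> x \<bullet> e = 2 * \<mu> - x \<bullet> e"
  by (simp add: reflect_def inner_diff_left ee)

lemma reflect_reflect: "reflect e \<mu> (reflect e \<mu> x) = x"
  unfolding reflect_def[of e \<mu> "reflect e \<mu> x"] reflect_inner
  by (simp add: reflect_def algebra_simps)

lemma reflect_add: "reflect e \<mu> (x + h) = reflect e \<mu> x + reflect e 0 h"
  by (simp add: reflect_def inner_add_left algebra_simps)

lemma reflect_eq: "reflect e \<mu> x = (2 * \<mu>) *\<^sub>R e + reflect e 0 x"
  by (simp add: reflect_def algebra_simps)

lemma norm_reflect_0: "norm (reflect e 0 x) = norm x"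
proof -
  have "(norm (reflect e 0 x))\<^sup>2 = (norm x)\<^sup>2"
    unfolding power2_norm_eq_inner reflect_def
    by (simp add: inner_diff_left inner_diff_right ee inner_commute[of e x] algebra_simps)
  then show ?thesis by simp
qed

lemma norm_reflect_diff: "norm (reflect e \<mu> x - reflect e \<mu> y) = norm (x - y)"
  using norm_reflect_0[of "x - y"] reflect_add[of \<mu> y "x - y"] by simp

lemma norm_reflect_minus: "(norm (reflect e \<mu> x - y))\<^sup>2 = (norm (x - y))\<^sup>2 + 4 * ((x \<bullet> e - \<mu>) * (y \<bullet> e - \<mu>))"
  unfolding power2_norm_eq_inner reflect_def
  by (simp add: inner_diff_left inner_diff_right ee inner_commute[of e x] inner_commute[of e y] inner_commute[of y x] algebra_simps)

lemma linear_reflect_0: "linear (reflect e 0)"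
  by (rule linearI) (auto simp: reflect_def inner_add_left algebra_simps)

lemma continuous_reflect: "continuous_on S (reflect e \<mu>)"
  unfolding reflect_def[abs_def] by (intro continuous_intros)

lemma reflect_measurable [measurable]: "reflect e \<mu> \<in> borel_measurable borel"
  by (rule borel_measurable_continuous_onI[OF continuous_reflect])

lemma distr_reflect_0: "distr lborel borel (reflect e 0) = lborel"
  using distr_lborel_isometric_involution[OF linear_reflect_0] norm_reflect_0 reflect_reflect by blast

lemma distr_reflect: "distr lborel borel (reflect e \<mu>) = lborel"
proof -
  have "distr lborel borel (reflect e \<mu>) = distr (distr lborel borel (reflect e 0)) borel ((+) ((2 * \<mu>) *\<^sub>R e))"
    by (subst distr_distr) (auto simp: comp_def reflect_eq[symmetric])
  then show ?thesis by (simp add: distr_reflect_0 lborel_distr_plus)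
qed

lemma integral_reflect:
  fixes f :: "'a \<Rightarrow> real"
  assumes [measurable]: "f \<in> borel_measurable borel"
  shows "(\<integral>x. f (reflect e \<mu> x) \<partial>lborel) = (\<integral>x. f x \<partial>lborel)"
  by (subst (2) distr_reflect[of \<mu>, symmetric], subst integral_distr; simp)

lemma integrable_reflect:
  fixes f :: "'a \<Rightarrow> real"
  assumes [measurable]: "f \<in> borel_measurable borel"
  shows "integrable lborel (\<lambda>x. f (reflect e \<mu> x)) \<longleftrightarrow> integrable lborel f"
  by (subst (2) distr_reflect[of \<mu>, symmetric], subst integrable_distr_eq; simp)

lemma continuous_compose_reflect:
  "continuous_on UNIV w \<Longrightarrow> continuous_on UNIV (\<lambda>x. w (reflect e \<mu> x))"
  by (rule continuous_on_compose2[OF _ continuous_reflect]) auto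

lemma mollify_reflect:
  assumes \<epsilon>: "\<epsilon> > 0" and w: "continuous_on UNIV w"
  shows "mollify \<epsilon> (\<lambda>x. w (reflect e \<mu> x)) z = mollify \<epsilon> w (reflect e \<mu> z)"
proof -
  note [measurable] = mollifier_measurable[OF \<epsilon>] borel_measurable_continuous_onI[OF w]
  have "mollify \<epsilon> (\<lambda>x. w (reflect e \<mu> x)) z = (\<integral>x. w (reflect e \<mu> z + reflect e 0 x) * mollifier \<epsilon> (reflect e 0 x) \<partial>lborel)"
    unfolding mollify_def reflect_add
    using mollifier_norm_cong[OF \<epsilon> norm_reflect_0] by simp
  also have "\<dots> = mollify \<epsilon> w (reflect e \<mu> z)"
    unfolding mollify_def by (rule integral_reflect[of "\<lambda>x. w (reflect e \<mu> z + x) * mollifier \<epsilon> x"]) measurable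
  finally show ?thesis .
qed

text \<open>Mollifier and kernel depend only on the norm of their argument, so the mollified equation is carried
  along by reflections; besides it is linear.\<close>

lemma mollified_eq_reflect_diff:
  assumes \<epsilon>: "\<epsilon> > 0" and uc: "uniformly_continuous_on UNIV u" and g: "continuous_on UNIV g"
    and z: "mollified_eq c s u g \<epsilon> z" and Rz: "mollified_eq c s u g \<epsilon> (reflect e \<mu> z)"
  shows "mollified_eq c s (\<lambda>x. u (reflect e \<mu> x) - u x) (\<lambda>x. g (reflect e \<mu> x) - g x) \<epsilon> z"
proof -
  note u = uniformly_continuous_imp_continuous[OF uc]
  let ?R = "reflect e \<mu>" and ?Q = "reflect e 0"
  let ?U = "mollify \<epsilon> u"
  have m: "?U \<in> borel_measurable borel"
    by (rule borel_measurable_continuous_onI[OF continuous_mollify[OF \<epsilon> uc]])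
  define F where "F z h = kern s h * second_diff ?U z h" for z h
  have Fm: "F z \<in> borel_measurable borel" for z
    using m unfolding F_def[abs_def] second_diff_def by measurable
  have sd: "second_diff (mollify \<epsilon> (\<lambda>x. u (?R x) - u x)) z h = second_diff ?U (?R z) (?Q h) - second_diff ?U z h" for h
  proof -
    have "?R (z - h) = ?R z - ?Q h" using reflect_add[of \<mu> z "- h"] linear_neg[OF linear_reflect_0] by simp
    then show ?thesis
      by (simp add: second_diff_def mollify_diff[OF \<epsilon> continuous_compose_reflect[OF u] u] mollify_reflect[OF \<epsilon> u] reflect_add)
  qed
  have "kern s h * second_diff (mollify \<epsilon> (\<lambda>x. u (?R x) - u x)) z h = F (?R z) (?Q h) - F z h" for h
    unfolding sd F_def right_diff_distrib using kern_norm_cong[OF norm_reflect_0, of s h] by simp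
  moreover have "integrable lborel (\<lambda>h. F (?R z) (?Q h))" "(\<integral>h. F (?R z) (?Q h) \<partial>lborel) = (\<integral>h. F (?R z) h \<partial>lborel)"
    using Rz integrable_reflect[OF Fm] integral_reflect[OF Fm] by (simp_all add: mollified_eq_def F_def[abs_def])
  moreover have "integrable lborel (F z)" "c / 2 * (\<integral>h. F z h \<partial>lborel) = mollify \<epsilon> g z"
      "c / 2 * (\<integral>h. F (?R z) h \<partial>lborel) = mollify \<epsilon> g (?R z)"
    using z Rz by (simp_all add: mollified_eq_def F_def[abs_def])
  moreover have "mollify \<epsilon> (\<lambda>x. g (?R x) - g x) z = mollify \<epsilon> g (?R z) - mollify \<epsilon> g z"
    by (simp add: mollify_diff[OF \<epsilon> continuous_compose_reflect[OF g] g] mollify_reflect[OF \<epsilon> g])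
  ultimately show ?thesis by (simp add: mollified_eq_def right_diff_distrib)
qed

section \<open>Antisymmetric functions\<close>

text \<open>With \<open>T(y) = K(y - z) (w(y) - w(z))\<close> the integral of the second differences is \<open>-2 \<integral> T\<close>, and
  averaging \<open>T\<close> over a point and its reflection gives \<open>D(y) = T(y) + T(R y)\<close>. By antisymmetry
  \<open>D(y) = (K(y - z) - K(R y - z)) (w(y) - w(z)) - 2 w(z) K(R y - z)\<close>. For \<open>y\<close> in the half-space both terms
  are nonnegative, since \<open>y\<close> is closer to \<open>z\<close> than \<open>R y\<close> is. The integrability of \<open>T\<close> itself is a
  consequence of that of the second differences: near \<open>z\<close> the function \<open>T\<close> is nonnegative, and away from
  \<open>z\<close> the kernel is integrable.\<close>

lemma antisymmetric_min_representation:
  fixes w :: "'a \<Rightarrow> real"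
  assumes s: "0 < s" "s < 1"
    and w: "continuous_on UNIV w" and bd: "\<And>y. \<bar>w y\<bar> \<le> B"
    and anti: "\<And>y. w (reflect e \<mu> y) = - w y"
    and z: "\<mu> < z \<bullet> e" and min: "\<And>y. \<mu> < y \<bullet> e \<Longrightarrow> w z \<le> w y" and wz: "w z \<le> 0"
    and int: "integrable lborel (\<lambda>h. kern s h * second_diff w z h)"
  defines "D \<equiv> \<lambda>y. kern s (y - z) * (w y - w z) + kern s (reflect e \<mu> y - z) * (- w y - w z)"
  shows "integrable lborel D"
    and "(\<integral>h. kern s h * second_diff w z h \<partial>lborel) = - (\<integral>y. D y \<partial>lborel)"
    and "\<And>y. 0 \<le> D y"
    and "\<And>y. \<mu> < y \<bullet> e \<Longrightarrow> - 2 * w z * kern s (reflect e \<mu> y - z) \<le> D y"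
    and "\<And>y. \<mu> < y \<bullet> e \<Longrightarrow> (kern s (y - z) - kern s (reflect e \<mu> y - z)) * (w y - w z) \<le> D y"
proof -
  let ?R = "reflect e \<mu>"
  have [measurable]: "w \<in> borel_measurable borel" using w by (simp add: borel_measurable_continuous_onI)
  define T where "T y = kern s (y - z) * (w y - w z)" for y
  have [measurable]: "T \<in> borel_measurable borel" unfolding T_def by measurable
  define d where "d = z \<bullet> e - \<mu>"
  have d: "0 < d" using z by (simp add: d_def)
  \<comment> \<open>A symmetric integrable correction that makes \<open>T(z + h)\<close> nonnegative; the nonnegative function is
    then bounded by its sum with its mirror image, which is integrable.\<close>
  define K where "K h = 2 * B * (indicator {h. d \<le> norm h} h * kern s h)" for h :: 'a
  have K: "integrable lborel K" unfolding K_def by (intro integrable_mult_right kern_integrable_away s d)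
  have [measurable]: "K \<in> borel_measurable borel" unfolding K_def by measurable
  have in_H: "\<mu> < y \<bullet> e" if "norm (y - z) < d" for y
  proof -
    have "\<bar>(y - z) \<bullet> e\<bar> \<le> norm (y - z) * norm e" by (rule Cauchy_Schwarz_ineq2)
    then show ?thesis using that e by (simp add: d_def inner_diff_left abs_le_iff)
  qed
  have P: "0 \<le> T (z + h) + K h" for h
  proof (cases "norm h < d")
    case True
    have "w z \<le> w (z + h)" using in_H[of "z + h"] True by (intro min) simp
    then show ?thesis using True kern_nonneg[of s h] by (simp add: T_def K_def)
  next
    case False
    have "- (2 * B) \<le> w (z + h) - w z" using bd[of z] bd[of "z + h"] by (simp add: abs_le_iff)
    from mult_left_mono[OF this kern_nonneg[of s h]] show ?thesis
      using False by (simp add: T_def K_def algebra_simps)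
  qed
  have sum: "T (z + h) + T (z + - h) = - (kern s h * second_diff w z h)" for h
    using kern_norm_cong[of "- h" h s] by (simp add: T_def second_diff_def algebra_simps)
  have K_sym: "K (- h) = K h" for h
    using kern_norm_cong[of "- h" h s] by (simp add: K_def indicator_def)
  have intP: "integrable lborel (\<lambda>h. (T (z + h) + K h) + (T (z + - h) + K h))"
  proof -
    have "integrable lborel (\<lambda>h. - (kern s h * second_diff w z h) + 2 * K h)"
      by (intro Bochner_Integration.integrable_add Bochner_Integration.integrable_minus integrable_mult_right int K)
    moreover have "- (kern s h * second_diff w z h) + 2 * K h = (T (z + h) + K h) + (T (z + - h) + K h)" for h
      unfolding sum[symmetric] by simp
    ultimately show ?thesis by (simp only:)
  qed
  have "integrable lborel (\<lambda>h. T (z + h) + K h)"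
  proof (rule Bochner_Integration.integrable_bound[OF intP])
    show "AE h in lborel. norm (T (z + h) + K h) \<le> norm ((T (z + h) + K h) + (T (z + - h) + K h))"
    proof (intro AE_I2)
      fix h show "norm (T (z + h) + K h) \<le> norm ((T (z + h) + K h) + (T (z + - h) + K h))"
        using P[of h] P[of "- h"] K_sym[of h] unfolding real_norm_def by linarith
    qed
  qed measurable
  from Bochner_Integration.integrable_diff[OF this K] have iT': "integrable lborel (\<lambda>h. T (z + h))" by simp
  then have iT: "integrable lborel T" using integrable_lborel_shift[of T z] by simp
  have neg: "distr lborel borel (uminus :: 'a \<Rightarrow> 'a) = lborel"
    by (rule distr_lborel_isometric_involution) (auto intro: linearI)
  have m': "(\<lambda>h. T (z + h)) \<in> borel_measurable borel" by measurable
  have iT'': "integrable lborel (\<lambda>h. T (z + - h))" "(\<integral>h. T (z + - h) \<partial>lborel) = (\<integral>h. T (z + h) \<partial>lborel)"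
    using integrable_distr_eq[of uminus lborel borel "\<lambda>h. T (z + h)"] integral_distr[of uminus lborel borel "\<lambda>h. T (z + h)"] iT' m'
    by (simp_all add: neg)
  have "- (\<integral>h. kern s h * second_diff w z h \<partial>lborel) = (\<integral>h. T (z + h) + T (z + - h) \<partial>lborel)"
    by (simp only: sum Bochner_Integration.integral_minus)
  also have "\<dots> = (\<integral>y. T y \<partial>lborel) + (\<integral>y. T y \<partial>lborel)"
    using iT' iT'' integral_lborel_shift[of T z] by simp
  finally have val: "(\<integral>h. kern s h * second_diff w z h \<partial>lborel) = - ((\<integral>y. T y \<partial>lborel) + (\<integral>y. T y \<partial>lborel))" by simp
  have D_T: "D y = T y + T (?R y)" for y by (simp add: D_def T_def anti)
  have iR: "integrable lborel (\<lambda>y. T (?R y))" "(\<integral>y. T (?R y) \<partial>lborel) = (\<integral>y. T y \<partial>lborel)"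
    using integrable_reflect[of T \<mu>] integral_reflect[of T \<mu>] iT by simp_all
  show "integrable lborel D" unfolding D_T[abs_def] using iT iR by simp
  show "(\<integral>h. kern s h * second_diff w z h \<partial>lborel) = - (\<integral>y. D y \<partial>lborel)"
    unfolding D_T[abs_def] val using iT iR by simp
  have kk: "(kern s (y - z) - kern s (?R y - z)) * (w y - w z) \<ge> 0" if y: "\<mu> < y \<bullet> e" for y
  proof (cases "y = z")
    case False
    have "(norm (y - z))\<^sup>2 \<le> (norm (?R y - z))\<^sup>2"
      using y z by (simp add: norm_reflect_minus mult_nonneg_nonneg)
    then have "norm (y - z) \<le> norm (?R y - z)" by (rule power2_le_imp_le) simp
    then show ?thesis using False s(1) min[OF y]
      by (intro mult_nonneg_nonneg) (auto intro!: kern_antimono)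
  qed simp
  have D_split: "D y = (kern s (y - z) - kern s (?R y - z)) * (w y - w z) + (- 2 * w z * kern s (?R y - z))" for y
    by (simp add: D_def algebra_simps)
  have last: "0 \<le> - 2 * w z * kern s (?R y - z)" for y
    using wz kern_nonneg[of s "?R y - z"] by (simp add: mult_nonpos_nonneg)
  show 1: "- 2 * w z * kern s (?R y - z) \<le> D y" if "\<mu> < y \<bullet> e" for y
    using kk[OF that] by (simp add: D_split)
  show "(kern s (y - z) - kern s (?R y - z)) * (w y - w z) \<le> D y" if "\<mu> < y \<bullet> e" for y
    using last[of y] by (simp add: D_split)
  have sym: "D (?R y) = D y" for y by (simp add: D_T reflect_reflect)
  have D_pos: "0 \<le> D y" if "\<mu> < y \<bullet> e" for y using 1[OF that] last[of y] by linarith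
  show "0 \<le> D y" for y
  proof -
    consider "\<mu> < y \<bullet> e" | "y \<bullet> e < \<mu>" | "y \<bullet> e = \<mu>" by linarith
    then show ?thesis
    proof cases
      case 2
      then have "\<mu> < ?R y \<bullet> e" by (simp add: reflect_inner)
      then show ?thesis using D_pos[of "?R y"] by (simp add: sym)
    next
      case 3
      then have "?R y = y" by (simp add: reflect_def)
      then have "w y = 0" using anti[of y] by simp
      then show ?thesis using wz kern_nonneg[of s "y - z"] \<open>?R y = y\<close> by (simp add: D_def mult_nonneg_nonpos mult_nonpos_nonneg)
    qed (rule D_pos)
  qed
qed

text \<open>Both parts read off the folded integral. For the estimate only the ball around \<open>z\<close> touching the
  hyperplane is kept: its points are mapped by \<open>R\<close> to distance at most \<open>3d\<close> from \<open>z\<close>, which gives a lower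
  bound \<open>-2 w(z) (3d)\<^sup>-\<^sup>N\<^sup>-\<^sup>2\<^sup>s\<close> for \<open>D\<close> on a set of volume proportional to \<open>d\<^sup>N\<close>. For the strong minimum
  principle, the integral of the nonnegative function \<open>D\<close> vanishes, whereas \<open>D > 0\<close> on the open set where
  \<open>w > 0\<close>.\<close>

lemma antisymmetric_min_principle:
  fixes w :: "'a \<Rightarrow> real"
  assumes c: "0 < c" and s: "0 < s" "s < 1"
    and uc: "uniformly_continuous_on UNIV w" and bd: "\<And>y. \<bar>w y\<bar> \<le> B"
    and anti: "\<And>y. w (reflect e \<mu> y) = - w y"
    and z: "\<mu> < z \<bullet> e" and min: "\<And>y. \<mu> < y \<bullet> e \<Longrightarrow> w z \<le> w y" and wz: "w z \<le> 0"
    and G: "continuous_on UNIV G"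
    and r0: "0 < r0" "\<And>\<epsilon> z'. 0 < \<epsilon> \<Longrightarrow> \<epsilon> < r0 \<Longrightarrow> dist z z' < r0 \<Longrightarrow> mollified_eq c s w G \<epsilon> z'"
  shows "G z * (z \<bullet> e - \<mu>) powr (2 * s) \<le> c * w z * (unit_ball_vol (real DIM('a)) / 3 powr (real DIM('a) + 2 * s))"
    and "w z = 0 \<Longrightarrow> 0 \<le> G z \<Longrightarrow> \<mu> < y \<bullet> e \<Longrightarrow> w y = 0"
proof -
  let ?R = "reflect e \<mu>" and ?N = "real DIM('a)"
  note w = uniformly_continuous_imp_continuous[OF uc]
  define d where "d = z \<bullet> e - \<mu>"
  have d: "0 < d" using z by (simp add: d_def)
  have in_H: "\<mu> < y \<bullet> e" if "dist z y < d" for y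
  proof -
    have "\<bar>(z - y) \<bullet> e\<bar> \<le> norm (z - y) * norm e" by (rule Cauchy_Schwarz_ineq2)
    then show ?thesis using that e by (simp add: d_def inner_diff_left abs_le_iff dist_norm)
  qed
  define I where "I = (\<integral>h. kern s h * second_diff w z h \<partial>lborel)"
  have int: "integrable lborel (\<lambda>h. kern s h * second_diff w z h)" and GI: "G z \<le> c / 2 * I"
    using local_min_inequality[OF c s uc bd G d _ r0] min in_H by (auto simp: I_def)
  define D where "D y = kern s (y - z) * (w y - w z) + kern s (?R y - z) * (- w y - w z)" for y
  note A = antisymmetric_min_representation[OF s w bd anti z min wz int, folded D_def[abs_def]]
  have D_int: "integrable lborel D" using A(1) by (simp add: D_def[abs_def])
  have I_D: "I = - (\<integral>y. D y \<partial>lborel)" using A(2) by (simp add: I_def)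
  have D0: "0 \<le> D y" for y using A(3)[of y] by (simp add: D_def)
  have D1: "- 2 * w z * kern s (?R y - z) \<le> D y" if "\<mu> < y \<bullet> e" for y using A(4)[of y] that by (simp add: D_def)
  have D2: "(kern s (y - z) - kern s (?R y - z)) * (w y - w z) \<le> D y" if "\<mu> < y \<bullet> e" for y
    using A(5)[of y] that by (simp add: D_def)
  have R_ne: "?R y \<noteq> z" if "\<mu> < y \<bullet> e" for y
    using reflect_inner[of \<mu> y] that z by auto
  show "G z * (z \<bullet> e - \<mu>) powr (2 * s) \<le> c * w z * (unit_ball_vol ?N / 3 powr (?N + 2 * s))"
  proof -
    define m where "m = - 2 * w z / (3 * d) powr (?N + 2 * s)"
    have m: "m * indicator (ball z d) y \<le> D y" for y
    proof (cases "dist z y < d")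
      case True
      note H = in_H[OF True]
      have "?R z - z = - ((2 * d) *\<^sub>R e)" by (simp add: reflect_def d_def)
      then have "norm (?R z - z) = 2 * d" using e d by simp
      moreover have "norm (?R y - ?R z) < d" using norm_reflect_diff[of \<mu> y z] True by (simp add: dist_norm norm_minus_commute)
      ultimately have "norm (?R y - z) \<le> 3 * d" using norm_triangle_ineq[of "?R y - ?R z" "?R z - z"] by simp
      then have "1 / (3 * d) powr (?N + 2 * s) \<le> kern s (?R y - z)"
        unfolding kern_def using R_ne[OF H] s(1) by (intro frac_le powr_mono2) auto
      then have "- 2 * w z * (1 / (3 * d) powr (?N + 2 * s)) \<le> - 2 * w z * kern s (?R y - z)"
        using wz by (intro mult_left_mono) auto
      then show ?thesis using D1[OF H] True by (simp add: m_def)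
    qed (use D0 in simp)
    have "m * (unit_ball_vol ?N * d ^ DIM('a)) = (\<integral>y. m * indicator (ball z d) y \<partial>lborel)"
      using d by (simp add: content_ball)
    also have "\<dots> \<le> (\<integral>y. D y \<partial>lborel)"
      by (intro integral_mono D_int m integrable_mult_right integrable_real_indicator)
         (auto simp: emeasure_ball d less_imp_le)
    finally have vol: "m * (unit_ball_vol ?N * d ^ DIM('a)) \<le> (\<integral>y. D y \<partial>lborel)" .
    have "G z \<le> - (c / 2) * (m * (unit_ball_vol ?N * d ^ DIM('a)))"
    proof -
      have "c / 2 * (m * (unit_ball_vol ?N * d ^ DIM('a))) \<le> c / 2 * (\<integral>y. D y \<partial>lborel)"
        using vol c by (intro mult_left_mono) auto
      then show ?thesis using GI by (simp add: I_D)
    qed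
    then have "G z * d powr (2 * s) \<le> - (c / 2) * (m * (unit_ball_vol ?N * d ^ DIM('a))) * d powr (2 * s)"
      by (rule mult_right_mono) simp
    also have "\<dots> = c * w z * (unit_ball_vol ?N / 3 powr (?N + 2 * s))"
      using d by (simp add: m_def powr_mult powr_add powr_realpow)
    finally show ?thesis by (simp add: d_def)
  qed
  show "w y = 0" if w0: "w z = 0" and G0: "0 \<le> G z" and y: "\<mu> < y \<bullet> e"
  proof -
    have "0 \<le> I" using order_trans[OF G0 GI] c by (simp add: zero_le_mult_iff)
    moreover have "0 \<le> (\<integral>y. D y \<partial>lborel)" using D0 by (rule Bochner_Integration.integral_nonneg)
    ultimately have "(\<integral>y. D y \<partial>lborel) = 0" by (simp add: I_D)
    then have "AE y in lborel. D y = 0"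
      using integral_nonneg_eq_0_iff_AE[OF D_int] D0 by simp
    moreover define S where "S = {y. \<mu> < y \<bullet> e} \<inter> {y. 0 < w y}"
    have "D y \<noteq> 0" if "y \<in> S" for y
    proof -
      have H: "\<mu> < y \<bullet> e" "0 < w y" using that by (auto simp: S_def)
      then have "y \<noteq> z" using w0 by auto
      moreover have "(norm (y - z))\<^sup>2 < (norm (?R y - z))\<^sup>2"
        using H z by (simp add: norm_reflect_minus)
      then have "norm (y - z) < norm (?R y - z)" by (rule power2_less_imp_less) simp
      ultimately have "kern s (?R y - z) < kern s (y - z)" using s(1) by (intro kern_strict_antimono) auto
      then have "0 < (kern s (y - z) - kern s (?R y - z)) * (w y - w z)" using H w0 by simp
      then show ?thesis using D2[OF H(1)] by simp
    qed
    ultimately have "AE y in lborel. y \<notin> S" by (auto elim!: eventually_mono)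
    moreover have "open S" unfolding S_def
      by (intro open_Int open_Collect_less continuous_intros w)
    ultimately have "S = {}" by (rule AE_notin_open_imp_empty[rotated])
    then show "w y = 0" using y min[OF y] w0 by (force simp: S_def)
  qed
qed

end

section \<open>Continuity and maxima\<close>

lemma attains_max_if_small_at_infinity:
  fixes v :: "'a::euclidean_space \<Rightarrow> real"
  assumes "closed S" "continuous_on S v" "x1 \<in> S" "0 < v x1"
    and small: "\<And>\<delta>. 0 < \<delta> \<Longrightarrow> \<exists>b. \<forall>y. b \<le> norm y \<longrightarrow> v y < \<delta>"
  obtains x where "x \<in> S" "v x1 \<le> v x" "\<forall>y\<in>S. v y \<le> v x"
proof -
  obtain b where b: "\<And>y. b \<le> norm y \<Longrightarrow> v y < v x1" using small[OF \<open>0 < v x1\<close>] by blast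
  let ?K = "S \<inter> cball 0 b"
  have x1: "x1 \<in> ?K" using b[of x1] \<open>x1 \<in> S\<close> by (cases "b \<le> norm x1") auto
  have "\<exists>x\<in>?K. \<forall>y\<in>?K. v y \<le> v x"
    using x1 assms(1,2) by (intro continuous_attains_sup closed_Int_compact) (auto intro: continuous_on_subset)
  then obtain x where x: "x \<in> ?K" "\<And>y. y \<in> ?K \<Longrightarrow> v y \<le> v x" by blast
  show ?thesis
  proof (rule that[of x])
    show "v x1 \<le> v x" using x(2) x1 by blast
    have "v y \<le> v x" if "y \<in> S" for y
      using x(2)[of y] x(2)[OF x1] b[of y] that by (cases "norm y \<le> b") auto
    then show "\<forall>y\<in>S. v y \<le> v x" by blast
  qed (use x in auto)
qed

lemma vanishing_eventually_small:
  fixes u :: "'a::euclidean_space \<Rightarrow> real"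
  assumes "(u \<longlongrightarrow> 0) at_infinity" "0 < \<delta>"
  shows "\<exists>b. \<forall>y. b \<le> norm y \<longrightarrow> u y < \<delta>"
  using order_tendstoD(2)[OF assms] by (auto simp: eventually_at_infinity)

lemma holder_uniformly_continuous:
  fixes u :: "'a::euclidean_space \<Rightarrow> real"
  assumes "holder_continuous s u" "0 < s" shows "uniformly_continuous_on UNIV u"
  unfolding uniformly_continuous_on_def
proof (intro allI impI)
  fix d :: real assume "0 < d"
  obtain L where L: "\<And>x y. \<bar>u x - u y\<bar> \<le> L * norm (x - y) powr s"
    using assms(1) by (auto simp: holder_continuous_def)
  define M where "M = \<bar>L\<bar> + 1"
  have M: "0 < M" "L \<le> M" by (auto simp: M_def)
  define \<delta> where "\<delta> = (d / M) powr (1 / s)"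
  have "0 < \<delta>" using M \<open>0 < d\<close> by (simp add: \<delta>_def)
  moreover have "dist (u y) (u x) < d" if "dist y x < \<delta>" for x y
  proof -
    have "norm (y - x) powr s < \<delta> powr s" using that assms(2) by (intro powr_less_mono2) (auto simp: dist_norm)
    also have "\<dots> = d / M" using M \<open>0 < d\<close> assms(2) by (simp add: \<delta>_def powr_powr)
    finally have "M * norm (y - x) powr s < d" using M by (simp add: field_simps)
    moreover have "L * norm (y - x) powr s \<le> M * norm (y - x) powr s" using M by (intro mult_right_mono) auto
    ultimately show ?thesis using L[of y x] by (simp add: dist_real_def)
  qed
  ultimately show "\<exists>\<delta>>0. \<forall>x\<in>UNIV. \<forall>y\<in>UNIV. dist y x < \<delta> \<longrightarrow> dist (u y) (u x) < d" by blast
qed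

lemma locally_lipschitz_continuous:
  assumes "locally_lipschitz f" shows "continuous_on UNIV f"
proof (intro continuous_at_imp_continuous_on ballI)
  fix t
  obtain \<epsilon> L where "0 < \<epsilon>" "L-lipschitz_on (cball t \<epsilon>) f" using assms unfolding locally_lipschitz_def by blast
  then have "continuous_on (ball t \<epsilon>) f"
    by (meson ball_subset_cball continuous_on_subset lipschitz_on_continuous_on)
  then show "isCont f t" using \<open>0 < \<epsilon>\<close> by (auto simp: continuous_on_eq_continuous_at)
qed

lemma exterior_ball_room:
  assumes "z \<notin> cball x0 \<rho>"
  obtains r0 where "0 < r0" "\<And>\<epsilon> z'. \<epsilon> < r0 \<Longrightarrow> dist z z' < r0 \<Longrightarrow> cball z' \<epsilon> \<subseteq> - cball x0 \<rho>"
proof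
  let ?r = "(dist x0 z - \<rho>) / 2"
  show "0 < ?r" using assms by simp
  fix \<epsilon> z' assume "\<epsilon> < ?r" "dist z z' < ?r"
  show "cball z' \<epsilon> \<subseteq> - cball x0 \<rho>"
  proof
    fix y assume "y \<in> cball z' \<epsilon>"
    then have "dist z y < dist x0 z - \<rho>"
      using dist_triangle[of z y z'] \<open>\<epsilon> < ?r\<close> \<open>dist z z' < ?r\<close> by simp
    then show "y \<in> - cball x0 \<rho>" using dist_triangle[of x0 z y] by (simp add: dist_commute)
  qed
qed

text \<open>If \<open>G z \<le> 0\<close>, then the nonnegative function \<open>K(h) (2u(z) - u(z+h) - u(z-h))\<close> has integral \<open>0\<close>, so
  \<open>u\<close> is constant; but it tends to \<open>0\<close> at infinity and is positive at \<open>z\<close>.\<close>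

lemma source_pos_at_exterior_max:
  fixes u :: "'a::euclidean_space \<Rightarrow> real"
  assumes c: "0 < c" and s: "0 < s" "s < 1"
    and uc: "uniformly_continuous_on UNIV u" and bd: "\<And>y. \<bar>u y\<bar> \<le> B"
    and lim: "(u \<longlongrightarrow> 0) at_infinity"
    and G: "continuous_on UNIV G"
    and eq: "\<And>\<epsilon> z. 0 < \<epsilon> \<Longrightarrow> cball z \<epsilon> \<subseteq> - cball x0 \<rho> \<Longrightarrow> mollified_eq c s u G \<epsilon> z"
    and z: "z \<notin> cball x0 \<rho>" and max: "\<And>y. u y \<le> u z" and pos: "0 < u z"
  shows "0 < G z"
proof (rule ccontr)
  assume "\<not> 0 < G z"
  note u = uniformly_continuous_imp_continuous[OF uc]
  obtain r0 where r0: "0 < r0" "\<And>\<epsilon> z'. \<epsilon> < r0 \<Longrightarrow> dist z z' < r0 \<Longrightarrow> cball z' \<epsilon> \<subseteq> - cball x0 \<rho>"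
    using exterior_ball_room[OF z] by blast
  define F where "F h = kern s h * second_diff (\<lambda>x. - u x) z h" for h
  have le: "F h \<le> 0" for h
    using max[of "z + h"] max[of "z - h"] kern_nonneg[of s h]
    by (auto simp: F_def second_diff_def intro!: mult_nonneg_nonpos)
  have "uniformly_continuous_on UNIV (\<lambda>x. - u x)" by (rule uniformly_continuous_on_minus[OF uc])
  from local_min_inequality[OF c s this, of B "\<lambda>x. - G x" r0 z r0]
  have F: "integrable lborel F" "- G z \<le> c / 2 * (\<integral>h. F h \<partial>lborel)"
    using bd max G r0 mollified_eq_minus[OF eq]
    by (auto simp: F_def[abs_def] continuous_on_minus)
  have "0 \<le> (\<integral>h. F h \<partial>lborel)" using order_trans[OF _ F(2), of 0] \<open>\<not> 0 < G z\<close> c by (simp add: zero_le_mult_iff)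
  moreover have "0 \<le> (\<integral>h. - F h \<partial>lborel)" using le by (intro Bochner_Integration.integral_nonneg) simp
  ultimately have "(\<integral>h. - F h \<partial>lborel) = 0" by simp
  then have AE: "AE h in lborel. - F h = 0"
    using integral_nonneg_eq_0_iff_AE[of lborel "\<lambda>h. - F h"] F(1) le by simp
  define S where "S = {h. u (z + h) < u z}"
  have "F h \<noteq> 0" if "h \<in> S" for h
  proof -
    have "h \<noteq> 0" "u (z + h) < u z" using that by (auto simp: S_def)
    then have "0 < kern s h" "second_diff (\<lambda>x. - u x) z h < 0"
      using max[of "z - h"] by (auto simp: kern_def second_diff_def)
    then show ?thesis by (simp add: F_def)
  qed
  with AE have "AE h in lborel. h \<notin> S" by (auto elim!: eventually_mono)
  moreover have "open S" unfolding S_def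
    by (intro open_Collect_less continuous_intros continuous_on_compose2[OF u]) auto
  ultimately have "S = {}" by (rule AE_notin_open_imp_empty[rotated])
  obtain b where b: "\<And>y. b \<le> norm y \<Longrightarrow> u y < u z" using vanishing_eventually_small[OF lim pos] by blast
  obtain y :: 'a where "norm y = \<bar>b\<bar>" using vector_choose_size[of "\<bar>b\<bar>"] by auto
  then have "y - z \<in> S" using b[of y] by (simp add: S_def)
  then show False using \<open>S = {}\<close> by blast
qed

section \<open>Moving planes\<close>

text \<open>The situation of the theorem after both preliminary comparisons with \<open>a\<close>. The weak equation is
  replaced by the mollified one, and \<open>u < a\<close> outside the ball is assumed.\<close>

locale moving_planes =
  fixes c s a \<rho> t0 :: real and x0 :: "'a::euclidean_space" and f :: "real \<Rightarrow> real" and u :: "'a \<Rightarrow> real"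
  assumes c: "0 < c" and s: "0 < s" "s < 1" and \<rho>: "0 < \<rho>"
    and lip: "locally_lipschitz f" and t0: "0 < t0" "antimono_on {0..t0} f"
    and uc: "uniformly_continuous_on UNIV u" and lim: "(u \<longlongrightarrow> 0) at_infinity"
    and eq: "\<And>\<epsilon> z. 0 < \<epsilon> \<Longrightarrow> cball z \<epsilon> \<subseteq> - cball x0 \<rho> \<Longrightarrow> mollified_eq c s u (\<lambda>x. f (u x)) \<epsilon> z"
    and nonneg: "\<And>x. 0 \<le> u x" and inside: "\<And>x. x \<in> cball x0 \<rho> \<Longrightarrow> u x = a"
    and outside: "\<And>x. x \<notin> cball x0 \<rho> \<Longrightarrow> u x < a"
begin

lemma u_le: "u x \<le> a" using inside outside by (cases "x \<in> cball x0 \<rho>") (auto simp: less_imp_le)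

lemma cont_u: "continuous_on UNIV u" by (rule uniformly_continuous_imp_continuous[OF uc])

lemma cont_fu: "continuous_on UNIV (\<lambda>x. f (u x))"
  by (rule continuous_on_compose2[OF locally_lipschitz_continuous[OF lip] cont_u]) simp

context
  fixes e :: 'a assumes e: "norm e = 1"
begin

lemma reflect_closer: "x0 \<bullet> e < \<mu> \<Longrightarrow> \<mu> < y \<bullet> e \<Longrightarrow> norm (reflect e \<mu> y - x0) < norm (y - x0)"
  by (rule power2_less_imp_less) (auto simp: norm_reflect_minus[OF e] mult_pos_neg)

lemma uniformly_continuous_reflect_diff: "uniformly_continuous_on UNIV (\<lambda>x. u (reflect e \<mu> x) - u x)"
proof (rule uniformly_continuous_on_diff[OF _ uc])
  show "uniformly_continuous_on UNIV (\<lambda>x. u (reflect e \<mu> x))"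
    using uc unfolding uniformly_continuous_on_def dist_norm by (metis norm_reflect_diff[OF e] UNIV_I)
qed

lemma min_principle:
  assumes \<mu>: "x0 \<bullet> e < \<mu>" and z: "\<mu> < z \<bullet> e" and Rz: "reflect e \<mu> z \<notin> cball x0 \<rho>"
    and min: "\<And>y. \<mu> < y \<bullet> e \<Longrightarrow> u (reflect e \<mu> z) - u z \<le> u (reflect e \<mu> y) - u y"
    and le: "u (reflect e \<mu> z) \<le> u z"
  shows "(f (u (reflect e \<mu> z)) - f (u z)) * (z \<bullet> e - \<mu>) powr (2 * s)
      \<le> c * (u (reflect e \<mu> z) - u z) * (unit_ball_vol (real DIM('a)) / 3 powr (real DIM('a) + 2 * s))"
    and "u (reflect e \<mu> z) = u z \<Longrightarrow> \<mu> < y \<bullet> e \<Longrightarrow> u (reflect e \<mu> y) = u y"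
proof -
  let ?R = "reflect e \<mu>"
  have "z \<notin> cball x0 \<rho>" using Rz reflect_closer[OF \<mu> z] by (simp add: dist_norm norm_minus_commute)
  then obtain r1 where r1: "0 < r1" "\<And>\<epsilon> z'. \<epsilon> < r1 \<Longrightarrow> dist z z' < r1 \<Longrightarrow> cball z' \<epsilon> \<subseteq> - cball x0 \<rho>"
    using exterior_ball_room by blast
  obtain r2 where r2: "0 < r2" "\<And>\<epsilon> z'. \<epsilon> < r2 \<Longrightarrow> dist (?R z) z' < r2 \<Longrightarrow> cball z' \<epsilon> \<subseteq> - cball x0 \<rho>"
    using exterior_ball_room[OF Rz] by blast
  have r: "mollified_eq c s (\<lambda>x. u (?R x) - u x) (\<lambda>x. f (u (?R x)) - f (u x)) \<epsilon> z'"
    if "0 < \<epsilon>" "\<epsilon> < min r1 r2" "dist z z' < min r1 r2" for \<epsilon> z'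
    using that r1(2)[of \<epsilon> z'] r2(2)[of \<epsilon> "?R z'"]
    by (intro mollified_eq_reflect_diff[OF e _ uc cont_fu] eq) (auto simp: dist_norm norm_reflect_diff[OF e])
  have bd: "\<bar>u (?R y) - u y\<bar> \<le> a" for y
    using nonneg[of y] nonneg[of "?R y"] u_le[of y] u_le[of "?R y"] by linarith
  have G: "continuous_on UNIV (\<lambda>x. f (u (?R x)) - f (u x))"
    by (intro continuous_intros cont_fu continuous_compose_reflect[OF e cont_fu])
  have r0: "0 < min r1 r2" using r1(1) r2(1) by simp
  note P = antisymmetric_min_principle[OF e c s uniformly_continuous_reflect_diff bd _ z min _ G r0 r]
  show "(f (u (?R z)) - f (u z)) * (z \<bullet> e - \<mu>) powr (2 * s)
      \<le> c * (u (?R z) - u z) * (unit_ball_vol (real DIM('a)) / 3 powr (real DIM('a) + 2 * s))"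
    by (rule P(1)) (use le in \<open>auto simp: reflect_reflect[OF e]\<close>)
  show "u (?R y) = u y" if "u (?R z) = u z" "\<mu> < y \<bullet> e"
  proof -
    have "u (?R y) - u y = 0"
      by (rule P(2)) (use le that in \<open>auto simp: reflect_reflect[OF e]\<close>)
    then show ?thesis by simp
  qed
qed

text \<open>The point of the ball furthest from the half-space has the value \<open>a\<close>, and its mirror image lies
  outside the ball.\<close>

lemma not_symmetric:
  assumes \<mu>: "x0 \<bullet> e < \<mu>" shows "\<exists>y. \<mu> < y \<bullet> e \<and> u (reflect e \<mu> y) \<noteq> u y"
proof (intro exI conjI)
  let ?p = "x0 - \<rho> *\<^sub>R e"
  let ?y = "reflect e \<mu> ?p"
  have pe: "?p \<bullet> e = x0 \<bullet> e - \<rho>" using ee[OF e] by (simp add: inner_diff_left)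
  show "\<mu> < ?y \<bullet> e" using \<mu> \<rho> by (simp add: reflect_inner[OF e] pe)
  have "?p \<in> cball x0 \<rho>" using e \<rho> by (simp add: dist_norm)
  then have "u (reflect e \<mu> ?y) = a" by (simp add: reflect_reflect[OF e] inside)
  moreover have "u ?y < a"
  proof (rule outside)
    have "?y - x0 = (\<rho> + 2 * (\<mu> - x0 \<bullet> e)) *\<^sub>R e" by (simp add: reflect_def pe ee[OF e] algebra_simps) (simp add: scaleR_2[symmetric] mult.commute)
    then have "norm (?y - x0) = \<rho> + 2 * (\<mu> - x0 \<bullet> e)" using e \<mu> \<rho> by simp
    then show "?y \<notin> cball x0 \<rho>" using \<mu> by (simp add: dist_norm norm_minus_commute)
  qed
  ultimately show "u (reflect e \<mu> ?y) \<noteq> u ?y" by simp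
qed

text \<open>The minimum is attained inside the half-space because the difference vanishes on the hyperplane
  and \<open>u - u \<circ> R \<le> u\<close>, where \<open>u\<close> tends to \<open>0\<close> at infinity. It is not attained where the reflected point lies in the
  ball, since \<open>u \<le> a\<close>. The value of \<open>u\<close> at the minimum point exceeds \<open>t0\<close>: otherwise monotonicity of \<open>f\<close>
  makes the right-hand side nonnegative, against the estimate at a negative minimum.\<close>

lemma negative_min:
  assumes \<mu>: "x0 \<bullet> e < \<mu>" and y: "\<mu> < y \<bullet> e" "u (reflect e \<mu> y) < u y"
  obtains z where "\<mu> < z \<bullet> e" "u (reflect e \<mu> z) < u z" "reflect e \<mu> z \<notin> cball x0 \<rho>" "t0 < u z"
    "\<And>y. \<mu> < y \<bullet> e \<Longrightarrow> u (reflect e \<mu> z) - u z \<le> u (reflect e \<mu> y) - u y"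
proof -
  let ?R = "reflect e \<mu>"
  define v where "v x = u x - u (?R x)" for x
  have small: "\<exists>b. \<forall>y. b \<le> norm y \<longrightarrow> v y < \<delta>" if \<delta>: "0 < \<delta>" for \<delta>
  proof -
    obtain b where b: "\<And>y. b \<le> norm y \<Longrightarrow> u y < \<delta>" using vanishing_eventually_small[OF lim \<delta>] by blast
    have "v y < \<delta>" if "b \<le> norm y" for y using b[OF that] nonneg[of "?R y"] by (simp add: v_def)
    then show ?thesis by blast
  qed
  have "closed {x. \<mu> \<le> x \<bullet> e}" by (intro closed_Collect_le continuous_intros)
  moreover have "continuous_on {x. \<mu> \<le> x \<bullet> e} v" unfolding v_def
    by (rule continuous_on_subset[OF _ subset_UNIV]) (intro continuous_intros cont_u continuous_compose_reflect[OF e cont_u])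
  moreover have "y \<in> {x. \<mu> \<le> x \<bullet> e}" "0 < v y" using y by (auto simp: v_def)
  ultimately obtain z where z: "z \<in> {x. \<mu> \<le> x \<bullet> e}" "v y \<le> v z" "\<forall>y\<in>{x. \<mu> \<le> x \<bullet> e}. v y \<le> v z"
    by (rule attains_max_if_small_at_infinity[OF _ _ _ _ small]) blast
  have vz: "0 < v z" using z(2) \<open>0 < v y\<close> by simp
  have "z \<bullet> e \<noteq> \<mu>"
  proof
    assume "z \<bullet> e = \<mu>"
    then have "?R z = z" by (simp add: reflect_def)
    then show False using vz by (simp add: v_def)
  qed
  then have zH: "\<mu> < z \<bullet> e" using z(1) by simp
  have lt: "u (?R z) < u z" using vz by (simp add: v_def)
  have Rz: "?R z \<notin> cball x0 \<rho>" using inside[of "?R z"] u_le[of z] lt by auto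
  have min: "u (?R z) - u z \<le> u (?R y) - u y" if "\<mu> < y \<bullet> e" for y
    using bspec[OF z(3), of y] that by (simp add: v_def)
  have "t0 < u z"
  proof (rule ccontr)
    assume "\<not> t0 < u z"
    then have "f (u z) \<le> f (u (?R z))"
      using monotone_onD[OF t0(2), of "u (?R z)" "u z"] lt nonneg[of "?R z"] by auto
    then have "0 \<le> (f (u (?R z)) - f (u z)) * (z \<bullet> e - \<mu>) powr (2 * s)" by simp
    also have "\<dots> \<le> c * (u (?R z) - u z) * (unit_ball_vol (real DIM('a)) / 3 powr (real DIM('a) + 2 * s))"
      by (rule min_principle(1)[OF \<mu> zH Rz min]) (use lt in auto)
    also have "\<dots> < 0" using lt c unit_ball_vol_pos[of "DIM('a)"]
      by (intro mult_neg_pos mult_pos_neg) auto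
    finally show False by simp
  qed
  then show ?thesis using that zH lt Rz min by blast
qed

text \<open>\<open>A\<close> is the set of positions for which the comparison fails. It is bounded, as a failure produces a
  point beyond the hyperplane where \<open>u > t0\<close>. A contradiction arises at its supremum \<open>\<Lambda>\<close>, where the
  comparison still holds by continuity, from a limit point of negative minimum points for positions
  in \<open>A\<close> tending to \<open>\<Lambda>\<close>.\<close>

lemma moving_plane:
  assumes "x0 \<bullet> e < \<mu>" "\<mu> < y \<bullet> e" shows "u y \<le> u (reflect e \<mu> y)"
proof -
  define M where "M \<mu> \<longleftrightarrow> (\<forall>y. \<mu> < y \<bullet> e \<longrightarrow> u y \<le> u (reflect e \<mu> y))" for \<mu>
  define A where "A = {\<mu>. x0 \<bullet> e < \<mu> \<and> \<not> M \<mu>}"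
  obtain b where b: "\<And>y. b \<le> norm y \<Longrightarrow> u y < t0" using vanishing_eventually_small[OF lim t0(1)] by blast
  have min_ex: "\<exists>z. \<mu> < z \<bullet> e \<and> u (reflect e \<mu> z) < u z \<and> reflect e \<mu> z \<notin> cball x0 \<rho> \<and> norm z \<le> b \<and>
      (\<forall>y. \<mu> < y \<bullet> e \<longrightarrow> u (reflect e \<mu> z) - u z \<le> u (reflect e \<mu> y) - u y)" if "\<mu> \<in> A" for \<mu>
  proof -
    from that obtain y where y: "x0 \<bullet> e < \<mu>" "\<mu> < y \<bullet> e" "u (reflect e \<mu> y) < u y" by (force simp: A_def M_def)
    obtain z where z: "\<mu> < z \<bullet> e" "u (reflect e \<mu> z) < u z" "reflect e \<mu> z \<notin> cball x0 \<rho>" "t0 < u z"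
      "\<And>y. \<mu> < y \<bullet> e \<Longrightarrow> u (reflect e \<mu> z) - u z \<le> u (reflect e \<mu> y) - u y"
      using negative_min[OF y] by blast
    have "norm z \<le> b" using b[of z] z(4) by (cases "b \<le> norm z") auto
    with z show ?thesis by blast
  qed
  have "A = {}"
  proof (rule ccontr)
    assume "A \<noteq> {}"
    have "bdd_above A"
    proof
      fix \<mu> assume "\<mu> \<in> A"
      then obtain z where "\<mu> < z \<bullet> e" "norm z \<le> b" using min_ex by blast
      moreover have "z \<bullet> e \<le> norm z * norm e" by (rule norm_cauchy_schwarz)
      ultimately show "\<mu> \<le> b" using e by simp
    qed
    define \<Lambda> where "\<Lambda> = Sup A"
    have A_le: "\<mu> \<le> \<Lambda>" if "\<mu> \<in> A" for \<mu> unfolding \<Lambda>_def by (rule cSup_upper[OF that \<open>bdd_above A\<close>])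
    obtain \<mu>1 where "\<mu>1 \<in> A" using \<open>A \<noteq> {}\<close> by blast
    then have \<Lambda>: "x0 \<bullet> e < \<Lambda>" using A_le[of \<mu>1] by (simp add: A_def)
    have M\<Lambda>: "u y \<le> u (reflect e \<Lambda> y)" if y: "\<Lambda> < y \<bullet> e" for y
    proof (rule tendsto_lowerbound)
      have "(\<lambda>\<mu>. reflect e \<mu> y) \<midarrow>\<Lambda>\<rightarrow> reflect e \<Lambda> y" unfolding reflect_def by (intro tendsto_intros)
      then have "(\<lambda>\<mu>. u (reflect e \<mu> y)) \<midarrow>\<Lambda>\<rightarrow> u (reflect e \<Lambda> y)"
        by (rule continuous_on_tendsto_compose[OF cont_u]) auto
      then show "((\<lambda>\<mu>. u (reflect e \<mu> y)) \<longlongrightarrow> u (reflect e \<Lambda> y)) (at_right \<Lambda>)"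
        by (rule tendsto_mono[rotated]) (simp add: at_le)
      have "u y \<le> u (reflect e \<mu> y)" if "\<Lambda> < \<mu>" "\<mu> < y \<bullet> e" for \<mu>
        using that A_le[of \<mu>] \<Lambda> by (force simp: A_def M_def)
      then show "\<forall>\<^sub>F \<mu> in at_right \<Lambda>. u y \<le> u (reflect e \<mu> y)"
        using eventually_at_right_less[of \<Lambda>] y unfolding eventually_at_right[OF y] by blast
    qed simp
    have "\<exists>\<mu>\<in>A. \<Lambda> - 1 / (real n + 1) < \<mu>" for n
      using less_cSup_iff[OF \<open>A \<noteq> {}\<close> \<open>bdd_above A\<close>, of "\<Lambda> - 1 / (real n + 1)"] by (simp add: \<Lambda>_def)
    then obtain \<mu> where \<mu>: "\<mu> n \<in> A" "\<Lambda> - 1 / (real n + 1) < \<mu> n" for n by metis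
    have \<mu>_lim: "\<mu> \<longlonglongrightarrow> \<Lambda>"
    proof (rule tendsto_sandwich[of "\<lambda>n. \<Lambda> - 1 / (real n + 1)" _ _ "\<lambda>_. \<Lambda>"])
      show "(\<lambda>n. \<Lambda> - 1 / (real n + 1)) \<longlonglongrightarrow> \<Lambda>" by real_asymp
    qed (use \<mu> A_le in \<open>auto simp: less_imp_le\<close>)
    obtain z where z: "\<mu> n < z n \<bullet> e" "u (reflect e (\<mu> n) (z n)) < u (z n)" "reflect e (\<mu> n) (z n) \<notin> cball x0 \<rho>"
        "norm (z n) \<le> b" "\<And>y. \<mu> n < y \<bullet> e \<Longrightarrow> u (reflect e (\<mu> n) (z n)) - u (z n) \<le> u (reflect e (\<mu> n) y) - u y" for n
      using min_ex[OF \<mu>(1)] by metis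
    have "\<forall>n. z n \<in> cball 0 b" using z(4) by simp
    then obtain zl r where r: "strict_mono r" "(z \<circ> r) \<longlonglongrightarrow> zl"
      using compact_cball[of "0::'a" b] unfolding compact_def by blast
    define m Z where "m = \<mu> \<circ> r" and "Z = z \<circ> r"
    have Z_lim: "Z \<longlonglongrightarrow> zl" using r(2) by (simp add: Z_def)
    have m_lim: "m \<longlonglongrightarrow> \<Lambda>" unfolding m_def by (rule LIMSEQ_subseq_LIMSEQ[OF \<mu>_lim r(1)])
    have RZ_lim: "(\<lambda>n. reflect e (m n) (Z n)) \<longlonglongrightarrow> reflect e \<Lambda> zl"
      unfolding reflect_def by (intro tendsto_intros m_lim Z_lim)
    have uZ_lim: "(\<lambda>n. u (Z n)) \<longlonglongrightarrow> u zl" by (rule continuous_on_tendsto_compose[OF cont_u Z_lim]) auto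
    have uRZ_lim: "(\<lambda>n. u (reflect e (m n) (Z n))) \<longlonglongrightarrow> u (reflect e \<Lambda> zl)"
      by (rule continuous_on_tendsto_compose[OF cont_u RZ_lim]) auto
    have d_lim: "(\<lambda>n. Z n \<bullet> e - m n) \<longlonglongrightarrow> zl \<bullet> e - \<Lambda>" by (intro tendsto_intros m_lim Z_lim)
    have Z: "m n < Z n \<bullet> e" "u (reflect e (m n) (Z n)) < u (Z n)" "reflect e (m n) (Z n) \<notin> cball x0 \<rho>"
      "x0 \<bullet> e < m n" for n
      using z(1-3)[of "r n"] \<mu>(1)[of "r n"] by (auto simp: m_def Z_def A_def)
    have Zmin: "u (reflect e (m n) (Z n)) - u (Z n) \<le> u (reflect e (m n) y) - u y" if "m n < y \<bullet> e" for n y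
      using z(5)[of "r n" y] that by (simp add: m_def Z_def)
    have "\<Lambda> \<le> zl \<bullet> e"
      using LIMSEQ_le_const[OF d_lim, of 0] Z(1) by (force simp: less_imp_le)
    then consider "zl \<bullet> e = \<Lambda>" | "\<Lambda> < zl \<bullet> e" by linarith
    then show False
    proof cases
      \<comment> \<open>The minimum points approach the hyperplane: the Lipschitz bound for \<open>f\<close> near \<open>u zl\<close> is too weak
        to balance the estimate at a negative minimum.\<close>
      case 1
      then have "reflect e \<Lambda> zl = zl" by (simp add: reflect_def)
      obtain \<epsilon> L where L: "0 < \<epsilon>" "L-lipschitz_on (cball (u zl) \<epsilon>) f" using lip unfolding locally_lipschitz_def by blast
      define \<kappa> where "\<kappa> = unit_ball_vol (real DIM('a)) / 3 powr (real DIM('a) + 2 * s)"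
      have \<kappa>: "0 < \<kappa>" using unit_ball_vol_pos[of "DIM('a)"] by (simp add: \<kappa>_def)
      have near: "\<forall>\<^sub>F n in sequentially. u (Z n) \<in> cball (u zl) \<epsilon> \<and> u (reflect e (m n) (Z n)) \<in> cball (u zl) \<epsilon>"
        using tendstoD[OF uZ_lim L(1)] tendstoD[OF uRZ_lim L(1)]
        by eventually_elim (auto simp: dist_commute \<open>reflect e \<Lambda> zl = zl\<close>)
      have "\<forall>\<^sub>F n in sequentially. c * \<kappa> \<le> L * (Z n \<bullet> e - m n) powr (2 * s)"
        using near
      proof eventually_elim
        case (elim n)
        define w where "w = u (Z n) - u (reflect e (m n) (Z n))"
        define p where "p = (Z n \<bullet> e - m n) powr (2 * s)"
        have "0 < w" using Z(2)[of n] by (simp add: w_def)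
        have "\<bar>f (u (Z n)) - f (u (reflect e (m n) (Z n)))\<bar> \<le> L * w"
          using lipschitz_onD[OF L(2), of "u (Z n)" "u (reflect e (m n) (Z n))"] elim \<open>0 < w\<close>
          by (simp add: dist_real_def w_def)
        then have "(f (u (Z n)) - f (u (reflect e (m n) (Z n)))) * p \<le> L * w * p"
          by (intro mult_right_mono) (auto simp: p_def)
        moreover have "(f (u (reflect e (m n) (Z n))) - f (u (Z n))) * p \<le> c * (- w) * \<kappa>"
          using min_principle(1)[OF Z(4,1,3) Zmin] Z(2)[of n] by (simp add: w_def p_def \<kappa>_def)
        ultimately have "(c * \<kappa>) * w \<le> (L * p) * w" by (simp add: algebra_simps)
        then show ?case using \<open>0 < w\<close> by (simp add: p_def)
      qed
      moreover have "(\<lambda>n. L * (Z n \<bullet> e - m n) powr (2 * s)) \<longlonglongrightarrow> L * 0"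
        by (intro tendsto_mult tendsto_const tendsto_zero_powrI[where b = "2 * s"])
           (use d_lim 1 Z(1) s in \<open>auto simp: less_imp_le\<close>)
      ultimately have "c * \<kappa> \<le> L * 0" by (intro tendsto_lowerbound) auto
      then show False using c \<kappa> by (simp add: mult_le_0_iff)
    next
      \<comment> \<open>The limit is an interior zero of the difference. It lies outside the ball,
        being farther from \<open>x0\<close> than its reflection, whose distance is at least \<open>\<rho>\<close>; hence \<open>u < a\<close> at
        both points, and the reflection is outside the ball as well.\<close>
      case 2
      have "u (reflect e \<Lambda> zl) \<le> u zl"
        by (rule LIMSEQ_le[OF uRZ_lim uZ_lim]) (use Z(2) in \<open>auto simp: less_imp_le\<close>)
      then have eq: "u (reflect e \<Lambda> zl) = u zl" using M\<Lambda>[OF 2] by simp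
      have "(\<lambda>n. dist x0 (reflect e (m n) (Z n))) \<longlonglongrightarrow> dist x0 (reflect e \<Lambda> zl)"
        by (intro tendsto_intros RZ_lim)
      then have "\<rho> \<le> dist x0 (reflect e \<Lambda> zl)"
        by (rule LIMSEQ_le_const) (use Z(3) in \<open>auto simp: not_le less_imp_le\<close>)
      then have "zl \<notin> cball x0 \<rho>" using reflect_closer[OF \<Lambda> 2] by (simp add: dist_norm norm_minus_commute)
      then have "reflect e \<Lambda> zl \<notin> cball x0 \<rho>" using inside[of "reflect e \<Lambda> zl"] outside[of zl] eq by auto
      then have "\<forall>y. \<Lambda> < y \<bullet> e \<longrightarrow> u (reflect e \<Lambda> y) = u y"
        using min_principle(2)[OF \<Lambda> 2] eq M\<Lambda> by force
      then show False using not_symmetric[OF \<Lambda>] by blast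
    qed
  qed
  then show ?thesis using assms by (auto simp: A_def M_def)
qed

lemma moving_plane_strict:
  assumes \<mu>: "x0 \<bullet> e < \<mu>" and y: "\<mu> < y \<bullet> e" "y \<notin> cball x0 \<rho>" shows "u y < u (reflect e \<mu> y)"
proof (rule ccontr)
  assume "\<not> u y < u (reflect e \<mu> y)"
  then have eq: "u (reflect e \<mu> y) = u y" using moving_plane[OF \<mu> y(1)] by simp
  then have "reflect e \<mu> y \<notin> cball x0 \<rho>" using inside[of "reflect e \<mu> y"] outside[OF y(2)] by auto
  then have "\<forall>z. \<mu> < z \<bullet> e \<longrightarrow> u (reflect e \<mu> z) = u z"
    using min_principle(2)[OF \<mu> y(1)] eq moving_plane[OF \<mu>] by force
  then show False using not_symmetric[OF \<mu>] by blast
qed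

end

lemma strictly_decreasing:
  assumes "norm (x - x0) < norm (y - x0)" "y \<notin> cball x0 \<rho>" shows "u y < u x"
proof -
  define l where "l = norm (y - x)"
  have l: "0 < l" using assms by (auto simp: l_def)
  \<comment> \<open>The hyperplane is the perpendicular bisector of \<open>x\<close> and \<open>y\<close>; \<open>x0\<close> lies on the side of \<open>x\<close>.\<close>
  define e where "e = (1 / l) *\<^sub>R (y - x)"
  have e: "norm e = 1" using l by (simp add: e_def l_def)
  have yx: "y - x = l *\<^sub>R e" using l by (simp add: e_def)
  define \<mu> where "\<mu> = (x \<bullet> e + y \<bullet> e) / 2"
  have "y \<bullet> e - x \<bullet> e = l" using ee[OF e] by (simp add: inner_diff_left[symmetric] yx)
  then have ye: "y \<bullet> e - \<mu> = l / 2" by (simp add: \<mu>_def field_simps)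
  have "0 < (norm (y - x0))\<^sup>2 - (norm (x - x0))\<^sup>2" using assms(1) by (simp add: power_strict_mono)
  also have "\<dots> = (y - x) \<bullet> (x + y - 2 *\<^sub>R x0)"
    by (simp add: power2_norm_eq_inner algebra_simps inner_commute)
  also have "\<dots> = l * (2 * (\<mu> - x0 \<bullet> e))"
    unfolding yx by (simp add: \<mu>_def algebra_simps inner_commute)
  finally have "x0 \<bullet> e < \<mu>" using l by (simp add: zero_less_mult_iff)
  moreover have "reflect e \<mu> y = x" using ye yx by (simp add: reflect_def algebra_simps)
  ultimately show ?thesis using moving_plane_strict[OF e, of \<mu> y] ye l assms(2) by simp
qed

text \<open>Points slightly closer to \<open>x0\<close> on the ray through \<open>x\<close> are strictly closer than \<open>y\<close>; let them tend
  to \<open>x\<close>.\<close>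

lemma radial_le:
  assumes "norm (x - x0) = norm (y - x0)" "y \<notin> cball x0 \<rho>" shows "u y \<le> u x"
proof (rule tendsto_lowerbound)
  have "((\<lambda>t. x0 + t *\<^sub>R (x - x0)) \<longlongrightarrow> x0 + 1 *\<^sub>R (x - x0)) (at_left 1)" by (intro tendsto_intros)
  then show "((\<lambda>t. u (x0 + t *\<^sub>R (x - x0))) \<longlongrightarrow> u x) (at_left 1)"
    using continuous_on_tendsto_compose[OF cont_u] by fastforce
  have pos: "0 < norm (y - x0)" using assms(2) \<rho> by (auto simp: dist_norm norm_minus_commute)
  have "u y \<le> u (x0 + t *\<^sub>R (x - x0))" if "0 < t" "t < 1" for t
    using strictly_decreasing[of "x0 + t *\<^sub>R (x - x0)" y] that assms pos by simp
  then show "\<forall>\<^sub>F t in at_left 1. u y \<le> u (x0 + t *\<^sub>R (x - x0))"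
    unfolding eventually_at_left[OF zero_less_one] by (intro exI[of _ 0]) auto
qed simp

lemma radial: "radially_symmetric x0 u" and decreasing: "radially_decreasing x0 \<rho> u"
proof -
  have eq: "u x = u y" if "norm (x - x0) = norm (y - x0)" for x y
  proof (cases "x \<in> cball x0 \<rho>")
    case True
    then have "y \<in> cball x0 \<rho>" using that by (simp add: dist_norm norm_minus_commute)
    with True show ?thesis by (simp only: inside)
  next
    case False
    then have "y \<notin> cball x0 \<rho>" using that by (simp add: dist_norm norm_minus_commute)
    with False show ?thesis using radial_le[OF that] radial_le[OF that[symmetric]] by simp
  qed
  obtain b :: 'a where b: "norm b = 1" using vector_choose_size[of 1] by auto
  show "radially_symmetric x0 u" unfolding radially_symmetric_def
    by (intro exI[of _ "\<lambda>r. u (x0 + r *\<^sub>R b)"] allI eq) (simp add: b)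
  show "radially_decreasing x0 \<rho> u" unfolding radially_decreasing_def
    using strictly_decreasing by blast
qed

end

theorem corollary1p11:
  fixes c s a \<rho> :: real
    and x0 :: "'a::euclidean_space"
    and f :: "real \<Rightarrow> real"
    and u :: "'a \<Rightarrow> real"
  assumes "c > 0"
    and "0 < s" and "s < 1"
    and "a > 0" and "\<rho> > 0"
    and "locally_lipschitz f"
    and "\<exists>t0>0. antimono_on {0..t0} f"
    and "f a \<le> 0"
    and "holder_continuous s u"
    and "weak_solution c s (- cball x0 \<rho>) (\<lambda>x. f (u x)) u"
    and "\<forall>x \<in> cball x0 \<rho>. u x = a"
    and "(u \<longlongrightarrow> 0) at_infinity"
  shows "((\<forall>x. x \<notin> cball x0 \<rho> \<longrightarrow> 0 \<le> u x \<and> u x \<le> a) \<longrightarrow>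
            radially_symmetric x0 u \<and> radially_decreasing x0 \<rho> u)
       \<and> ((\<forall>t\<ge>0. f t \<le> 0) \<longrightarrow> (\<forall>x. x \<notin> cball x0 \<rho> \<longrightarrow> 0 \<le> u x) \<longrightarrow>
            radially_symmetric x0 u \<and> radially_decreasing x0 \<rho> u)"
proof -
  obtain t0 where t0: "0 < t0" "antimono_on {0..t0} f" using assms(7) by blast
  have uc: "uniformly_continuous_on UNIV u" by (rule holder_uniformly_continuous[OF assms(9,2)])
  note cu = uniformly_continuous_imp_continuous[OF uc]
  have cfu: "continuous_on UNIV (\<lambda>x. f (u x))"
    by (rule continuous_on_compose2[OF locally_lipschitz_continuous[OF assms(6)] cu]) simp
  have eq: "mollified_eq c s u (\<lambda>x. f (u x)) \<epsilon> z" if "0 < \<epsilon>" "cball z \<epsilon> \<subseteq> - cball x0 \<rho>" for \<epsilon> z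
    by (rule weak_solution_mollified_eq[OF assms(10,9) cu cfu assms(2,3) that])
  have no_max: "0 < f (u z)" if nonneg: "\<And>x. 0 \<le> u x" and "z \<notin> cball x0 \<rho>" "\<And>y. u y \<le> u z" "0 < u z" for z
    by (rule source_pos_at_exterior_max[OF assms(1-3) uc _ assms(12) cfu eq that(2-4), of "u z"])
       (use that in auto)
  have main: "radially_symmetric x0 u \<and> radially_decreasing x0 \<rho> u"
    if nonneg: "\<And>x. 0 \<le> u x" and le: "\<And>x. u x \<le> a"
  proof -
    have "u x < a" if x: "x \<notin> cball x0 \<rho>" for x
    proof (rule ccontr)
      assume "\<not> u x < a"
      then have "u x = a" using le[of x] by simp
      with no_max[OF nonneg x] le assms(4,8) show False by simp
    qed
    then interpret moving_planes c s a \<rho> t0 x0 f u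
      using assms t0 uc eq nonneg by unfold_locales auto
    show ?thesis using radial decreasing by blast
  qed
  show ?thesis
  proof (rule conjI; intro impI)
    assume h: "\<forall>x. x \<notin> cball x0 \<rho> \<longrightarrow> 0 \<le> u x \<and> u x \<le> a"
    have "0 \<le> u x" "u x \<le> a" for x
      using h assms(4,11) by (cases "x \<in> cball x0 \<rho>"; simp)+
    then show "radially_symmetric x0 u \<and> radially_decreasing x0 \<rho> u" by (rule main)
  next
    assume f0: "\<forall>t\<ge>0. f t \<le> 0" and h: "\<forall>x. x \<notin> cball x0 \<rho> \<longrightarrow> 0 \<le> u x"
    have nonneg: "0 \<le> u x" for x
      using h assms(4,11) by (cases "x \<in> cball x0 \<rho>") auto
    moreover have "u x \<le> a" for x
    proof (rule ccontr)
      assume "\<not> u x \<le> a"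
      then have "0 < u x" using assms(4) by simp
      obtain z where z: "u x \<le> u z" "\<forall>y\<in>UNIV. u y \<le> u z"
        by (rule attains_max_if_small_at_infinity[OF closed_UNIV cu UNIV_I \<open>0 < u x\<close> vanishing_eventually_small[OF assms(12)]])
      have "z \<notin> cball x0 \<rho>" using z(1) \<open>\<not> u x \<le> a\<close> assms(11) by auto
      then have "0 < f (u z)" using z less_le_trans[OF \<open>0 < u x\<close> z(1)] by (intro no_max nonneg) auto
      then show False using f0 nonneg[of z] by (simp add: not_less[symmetric])
    qed
    ultimately show "radially_symmetric x0 u \<and> radially_decreasing x0 \<rho> u" by (rule main)
  qed
qed

end
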